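(* Let $\mathcal R^q:\mathcal A^{\mathbb N}\to\mathcal A^{\mathbb N}$ be the map $P\mapsto\hat P$ given, for $\alpha\ge0$, $\beta\ge1$ and with $p_{-1}^q=p_{-1}^m=0$, by $$\hat p_0=u_xp_0+p_1^r,\quad \hat p_\alpha^q=q_{\alpha,x}p_0+p_{\alpha-1}^q,\quad \hat p_\alpha^m=m_{\alpha,x}p_0-\frac1t\,p_{\alpha-1}^m-\frac zt\,p_\alpha^m,\quad \hat p_\beta^r=r_{\beta,x}p_0-p_{\beta+1}^r,$$ and let $\mathcal R^m=t\,\mathcal R^q+z\,\mathcal I$, where $\mathcal I$ is the identity map of $\mathcal A^{\mathbb N}$. Then the restrictions $\mathcal R^q:\mathrm{sym}_{\mathcal A}^{\tau^W}(\mathcal E)\to\mathrm{sym}_{\mathcal A}^{\tau^W}(\mathcal E)$ and $\mathcal R^m:\mathrm{sym}_{\mathcal A}^{\tau^W}(\mathcal E)\to\mathrm{sym}_{\mathcal A}^{\tau^W}(\mathcal E)$ are automorphisms of the real vector space $\mathrm{sym}_{\mathcal A}^{\tau^W}(\mathcal E)$. Their inverses, $\hat P\mapsto P$, are determined for all $\alpha\ge0$, $\beta\ge1$, with the notation $\hat p_0^r=-\hat p_0$, by the following formulas. For $(\mathcal R^q)^{-1}$: $$p_0=\frac{\hat p_0^q}{q_{0,x}},\qquad p_\alpha^q=-\frac{q_{\alpha+1,x}}{q_{0,x}}\hat p_0^q+\hat p_{\alpha+1}^q,$$ $$p_\alpha^m=\sum_{j=0}^\alpha\frac{t\,\hat p_j^m}{(-z)^{\alpha-j+1}}-\frac{t\,\hat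 p_0^q}{q_{0,x}}\sum_{j=0}^\alpha\frac{m_{j,x}}{(-z)^{\alpha-j+1}},\qquad p_\beta^r=\frac{r_{\beta-1,x}}{q_{0,x}}\hat p_0^q-\hat p_{\beta-1}^r.$$ For $(\mathcal R^m)^{-1}$: $$p_0=\frac{\hat p_0^m}{t\,m_{0,x}},\qquad p_\alpha^q=\sum_{j=0}^\alpha\frac{(-t)^{\alpha-j}\hat p_j^q}{z^{\alpha-j+1}}-\frac{\hat p_0^m}{m_{0,x}}\sum_{j=0}^\alpha\frac{(-t)^{\alpha-j}q_{j,x}}{z^{\alpha-j+1}},$$ $$p_\alpha^m=\frac{m_{\alpha+1,x}}{m_{0,x}}\hat p_0^m-\hat p_{\alpha+1}^m,\qquad p_\beta^r=-\sum_{j=0}^{\beta-1}\frac{z^{\beta-j-1}\hat p_j^r}{t^{\beta-j}}+\frac{\hat p_0^m}{m_{0,x}}\left(-\frac{z^\beta}{t^{\beta+1}}+\sum_{j=1}^{\beta}\frac{z^{\beta-j}r_{j-1,x}}{t^{\beta-j+1}}\right).$$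
   Context: $\mathcal E$ is the reduced quasi-classical self-dual Yang-Mills equation $u_{yz}=u_{tx}-u_zu_{xx}+u_xu_{xz}$. **The space $\tilde{\mathcal E}^W$.** Its (internal) coordinates are: $x,y,z,t$; $u_{x^it^j}$ ($i,j\ge0$), $u_{x^iy^kt^j}$ and $u_{x^iz^lt^j}$ ($i,j\ge 0$, $k,l\ge1$); $q_\alpha^{a,b}$, $m_\alpha^{a,b}$ ($\alpha,a,b\ge0$); $r_\beta^{a,b}$ ($\beta\ge1$, $a,b\ge0$). Write $u=u_{x^0t^0}$, $q_\alpha=q_\alpha^{0,0}$, $m_\alpha=m_\alpha^{0,0}$, $r_\beta=r_\beta^{0,0}$, and set $r_0=-u$, $q_{-1}^{a,b}=m_{-1}^{a,b}=0$. Every function considered depends on finitely many of these coordinates. **The algebra $\mathcal A$.** $\mathcal A$ is the commutative $\mathbb R$-algebra generated by $\mathcal L\cup\mathcal F$, where $\mathcal F$ is the algebra of smooth functions of (finitely many of) the internal coordinates on $\tilde{\mathcal E}^W$ and $\mathcal L$ is the algebra of Laurent polynomials with real coefficients in (finitely many of) the internal coordinates. Elements of $\mathcal A$ are smooth functions defined where the finitely many inverted coordinates are nonzero, two being identified if they agree on such a common dense open set. $\mathcal A^{\mathbb N}$ is the $\mathcal A$-module of all sequences of elements of $\mathcal A$, written $P=[p_0,p_0^q,p_0^m,p_1^r,p_1^q,p_1^m,p_2^r,p_2^q,p_2^m,\ldots]$. **Total derivatives.** $\tilde D_x,\tilde D_y,\tilde D_z,\tilde D_t$ are the derivations (vector fields)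 on functions on $\tilde{\mathcal E}^W$ acting on $x,y,z,t$ as the corresponding partial derivatives and on the other coordinates as follows. Put $G=u_{tx}-u_zu_{xx}+u_xu_{xz}$. - $\tilde D_x$ and $\tilde D_t$ raise $i$, resp. $j$, by one in every $u$-coordinate. - $\tilde D_y u_{x^it^j}=u_{x^iyt^j}$, $\tilde D_yu_{x^iy^kt^j}=u_{x^iy^{k+1}t^j}$, $\tilde D_yu_{x^iz^lt^j}=\tilde D_x^i\tilde D_z^{l-1}\tilde D_t^j(G)$. - $\tilde D_z u_{x^it^j}=u_{x^izt^j}$, $\tilde D_zu_{x^iz^lt^j}=u_{x^iz^{l+1}t^j}$, $\tilde D_zu_{x^iy^kt^j}=\tilde D_x^i\tilde D_y^{k-1}\tilde D_t^j(G)$. - $\tilde D_xq_\alpha^{a,b}=q_\alpha^{a+1,b}$, $\tilde D_zq_\alpha^{a,b}=q_\alpha^{a,b+1}$, $\tilde D_yq_\alpha^{a,b}=\tilde D_x^a\tilde D_z^b(u_xq_\alpha^{1,0}+q_{\alpha-1}^{1,0})$, $\tilde D_tq_\alpha^{a,b}=\tilde D_x^a\tilde D_z^b(u_zq_\alpha^{1,0}+q_{\alpha-1}^{0,1})$. - $\tilde D_xm_\alpha^{a,b}=m_\alpha^{a+1,b}$, $\tilde D_zm_\alpha^{a,b}=m_\alpha^{a,b+1}$, $\tilde D_ym_\alpha^{a,b}=\tilde D_x^a\tilde D_z^b\big(u_xm_\alpha^{1,0}-\frac zt m_\alpha^{1,0}-\frac1t m_{\alpha-1}^{1,0}\big)$,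 $\tilde D_tm_\alpha^{a,b}=\tilde D_x^a\tilde D_z^b\big(u_zm_\alpha^{1,0}-\frac zt m_\alpha^{0,1}-\frac1t m_{\alpha-1}^{0,1}\big)$. - $\tilde D_yr_\beta^{a,b}=r_\beta^{a+1,b}$, $\tilde D_tr_\beta^{a,b}=r_\beta^{a,b+1}$, and inductively on $\beta\ge1$: $\tilde D_xr_\beta^{a,b}=\tilde D_y^a\tilde D_t^b(u_x\tilde D_xr_{\beta-1}-\tilde D_yr_{\beta-1})$, $\tilde D_zr_\beta^{a,b}=\tilde D_y^a\tilde D_t^b(u_z\tilde D_xr_{\beta-1}-\tilde D_tr_{\beta-1})$. These four derivations pairwise commute. Subscripts denote total derivatives: $q_{\alpha,x}=\tilde D_xq_\alpha=q_\alpha^{1,0}$, $m_{\alpha,x}=\tilde D_xm_\alpha=m_\alpha^{1,0}$, $r_{\beta,x}=\tilde D_xr_\beta$ (so $r_{0,x}=-u_x$), etc.; $\tilde D_{yz}=\tilde D_y\tilde D_z$, etc. **$\tau^W$-symmetries.** $\mathrm{sym}_{\mathcal A}^{\tau^W}(\mathcal E)\subset\mathcal A^{\mathbb N}$ is the real vector space of all $P\in\mathcal A^{\mathbb N}$ satisfying, for all $\alpha\ge0$, $\beta\ge2$, with $p_{-1}^q=p_{-1}^m=0$: - (NS1) $\tilde D_{yz}(p_0)-\tilde D_{tx}(p_0)+u_z\tilde D_{xx}(p_0)-u_x\tilde D_{xz}(p_0)+u_{xx}\tilde D_z(p_0)-u_{xz}\tilde D_x(p_0)=0$; - (NS2) $\tilde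 D_t(p_\alpha^q)-u_z\tilde D_x(p_\alpha^q)-q_{\alpha,x}\tilde D_z(p_0)-\tilde D_z(p_{\alpha-1}^q)=0$; - (NS3) $\tilde D_y(p_\alpha^q)-u_x\tilde D_x(p_\alpha^q)-q_{\alpha,x}\tilde D_x(p_0)-\tilde D_x(p_{\alpha-1}^q)=0$; - (NS4) $\tilde D_t(p_\alpha^m)-u_z\tilde D_x(p_\alpha^m)-m_{\alpha,x}\tilde D_z(p_0)+\frac zt\tilde D_z(p_\alpha^m)+\frac1t\tilde D_z(p_{\alpha-1}^m)=0$; - (NS5) $\tilde D_y(p_\alpha^m)-u_x\tilde D_x(p_\alpha^m)-m_{\alpha,x}\tilde D_x(p_0)+\frac zt\tilde D_x(p_\alpha^m)+\frac1t\tilde D_x(p_{\alpha-1}^m)=0$; - (NS6) $\tilde D_x(p_1^r)-\tilde D_y(p_0)+2u_x\tilde D_x(p_0)=0$; - (NS7) $\tilde D_z(p_1^r)-\tilde D_t(p_0)+u_x\tilde D_z(p_0)+u_z\tilde D_x(p_0)=0$; - (NS8) $\tilde D_x(p_\beta^r)-u_x\tilde D_x(p_{\beta-1}^r)-r_{\beta-1,x}\tilde D_x(p_0)+\tilde D_y(p_{\beta-1}^r)=0$; - (NS9) $\tilde D_z(p_\beta^r)-u_z\tilde D_x(p_{\beta-1}^r)-r_{\beta-1,x}\tilde D_z(p_0)+\tilde D_t(p_{\beta-1}^r)=0$. *)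

theory Defs
  imports "HOL-Analysis.Analysis" "HOL-Library.Function_Algebras"
begin

text \<open>
  Internal coordinates. The encoding contains no junk: \<open>cU i j\<close> is \<open>u\<close> with lower index
  \<open>x^i t^j\<close>, \<open>cUY i k j\<close> has lower index \<open>x^i y^(k+1) t^j\<close>, \<open>cUZ i l j\<close> has lower index
  \<open>x^i z^(l+1) t^j\<close>, \<open>cQ \<alpha> a b\<close> and \<open>cM \<alpha> a b\<close> are \<open>q\<close> and \<open>m\<close> with lower index \<open>\<alpha>\<close> and
  upper index \<open>(a,b)\<close>, and \<open>cR \<beta> a b\<close> is \<open>r\<close> with lower index \<open>\<beta>+1\<close> and upper index \<open>(a,b)\<close>.
\<close>

datatype coord =
    cX | cY | cZ | cT
  | cU nat nat
  | cUY nat nat nat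
  | cUZ nat nat nat
  | cQ nat nat nat
  | cM nat nat nat
  | cR nat nat nat

type_synonym point = "coord \<Rightarrow> real"

definition pd :: "coord \<Rightarrow> (point \<Rightarrow> real) \<Rightarrow> point \<Rightarrow> real" where
  "pd c f p = deriv (\<lambda>s. f (p(c := s))) (p c)"

definition depends_only_on :: "coord set \<Rightarrow> (point \<Rightarrow> real) \<Rightarrow> bool" where
  "depends_only_on S f \<longleftrightarrow> (\<forall>p p'. (\<forall>c\<in>S. p c = p' c) \<longrightarrow> f p = f p')"

text \<open>
  All iterated partial derivatives exist and are continuous. For a function of finitely many
  coordinates, continuity for the product topology on \<^typ>\<open>point\<close> is continuity in these
  coordinates.
\<close>

definition smooth_fun :: "(point \<Rightarrow> real) \<Rightarrow> bool" where
  "smooth_fun f \<longleftrightarrow>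
    (\<forall>cs. continuous_on UNIV (foldr pd cs f) \<and>
          (\<forall>c p. (\<lambda>s. foldr pd cs f (p(c := s))) differentiable (at (p c))))"

definition smooth_algebra :: "(point \<Rightarrow> real) set" where
  "smooth_algebra = {f. smooth_fun f \<and> (\<exists>S. finite S \<and> depends_only_on S f)}"

definition laurent_algebra :: "(point \<Rightarrow> real) set" where
  "laurent_algebra =
    {f. \<exists>(I :: nat set) S a e. finite I \<and> finite S \<and>
          f = (\<lambda>p. \<Sum>i\<in>I. a i * (\<Prod>c\<in>S. p c powi e i c))}"

inductive_set gen_algebra :: "(point \<Rightarrow> real) set" where
  base: "f \<in> smooth_algebra \<union> laurent_algebra \<Longrightarrow> f \<in> gen_algebra"
| add: "f \<in> gen_algebra \<Longrightarrow> g \<in> gen_algebra \<Longrightarrow> (\<lambda>p. f p + g p) \<in> gen_algebra"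
| mult: "f \<in> gen_algebra \<Longrightarrow> g \<in> gen_algebra \<Longrightarrow> (\<lambda>p. f p * g p) \<in> gen_algebra"

text \<open>
  Functions are total here, so an inverted coordinate takes the value 0 where it is not
  defined. The relation \<open>agree\<close> forgets these values: it only compares two functions where
  finitely many coordinates are nonzero, which is a dense open set.
\<close>

definition nonzero_on :: "coord set \<Rightarrow> point set" where
  "nonzero_on S = {p. \<forall>c\<in>S. p c \<noteq> 0}"

definition agree :: "(point \<Rightarrow> real) \<Rightarrow> (point \<Rightarrow> real) \<Rightarrow> bool" where
  "agree f g \<longleftrightarrow> (\<exists>S. finite S \<and> (\<forall>p\<in>nonzero_on S. f p = g p))"

definition representative :: "(point \<Rightarrow> real) \<Rightarrow> bool" where
  "representative f \<longleftrightarrow> (\<exists>g\<in>gen_algebra. agree f g)"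

definition alg_rel :: "(point \<Rightarrow> real) \<Rightarrow> (point \<Rightarrow> real) \<Rightarrow> bool" where
  "alg_rel f g \<longleftrightarrow> representative f \<and> representative g \<and> agree f g"

lemma nonzero_on_Un: "nonzero_on (S \<union> S') = nonzero_on S \<inter> nonzero_on S'"
  by (auto simp: nonzero_on_def)

lemma agreeI: "finite S \<Longrightarrow> (\<And>p. p \<in> nonzero_on S \<Longrightarrow> f p = g p) \<Longrightarrow> agree f g"
  unfolding agree_def by auto

lemma agree_refl [simp]: "agree f f"
  unfolding agree_def by (rule exI[of _ "{}"]) simp

lemma agree_sym: "agree f g \<Longrightarrow> agree g f"
  unfolding agree_def by auto

lemma agree_combine:
  assumes "agree f f'" "agree g g'"
  obtains S where "finite S" "\<And>p. p \<in> nonzero_on S \<Longrightarrow> f p = f' p"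
    "\<And>p. p \<in> nonzero_on S \<Longrightarrow> g p = g' p"
proof -
  from assms obtain S S' where "finite S" "\<forall>p\<in>nonzero_on S. f p = f' p"
     "finite S'" "\<forall>p\<in>nonzero_on S'. g p = g' p"
    unfolding agree_def by blast
  then show ?thesis using that[of "S \<union> S'"] by (simp add: nonzero_on_Un)
qed

lemma agree_trans: "agree f g \<Longrightarrow> agree g h \<Longrightarrow> agree f h"
  by (erule (1) agree_combine, erule agreeI) simp

lemma agree_add: "agree f f' \<Longrightarrow> agree g g' \<Longrightarrow> agree (\<lambda>p. f p + g p) (\<lambda>p. f' p + g' p)"
  by (erule (1) agree_combine, erule agreeI) simp

lemma agree_mult: "agree f f' \<Longrightarrow> agree g g' \<Longrightarrow> agree (\<lambda>p. f p * g p) (\<lambda>p. f' p * g' p)"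
  by (erule (1) agree_combine, erule agreeI) simp

lemma representative_gen: "f \<in> gen_algebra \<Longrightarrow> representative f"
  unfolding representative_def using agree_refl by blast

lemma representative_add:
  assumes "representative f" "representative g"
  shows "representative (\<lambda>p. f p + g p)"
proof -
  from assms obtain f' g' where "f' \<in> gen_algebra" "agree f f'" "g' \<in> gen_algebra" "agree g g'"
    unfolding representative_def by blast
  then show ?thesis
    unfolding representative_def
    by (intro bexI[of _ "\<lambda>p. f' p + g' p"] agree_add gen_algebra.add)
qed

lemma representative_mult:
  assumes "representative f" "representative g"
  shows "representative (\<lambda>p. f p * g p)"
proof -
  from assms obtain f' g' where "f' \<in> gen_algebra" "agree f f'" "g' \<in> gen_algebra" "agree g g'"
    unfolding representative_def by blast
  then show ?thesis
    unfolding representative_def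
    by (intro bexI[of _ "\<lambda>p. f' p * g' p"] agree_mult gen_algebra.mult)
qed

lemma laurent_monomial:
  assumes "finite S"
  shows "(\<lambda>p. a * (\<Prod>c\<in>S. p c powi e c)) \<in> laurent_algebra"
  unfolding laurent_algebra_def mem_Collect_eq
  by (rule exI[of _ "{0}"], rule exI[of _ S], rule exI[of _ "\<lambda>_. a"], rule exI[of _ "\<lambda>_. e"])
    (use assms in simp)

lemma gen_monomial:
  assumes "finite S"
  shows "(\<lambda>p. a * (\<Prod>c\<in>S. p c powi e c)) \<in> gen_algebra"
  using laurent_monomial[OF assms] by (simp add: gen_algebra.base)

lemma gen_const: "(\<lambda>p. a) \<in> gen_algebra"
  using gen_monomial[of "{}" a] by simp

lemma gen_coord: "(\<lambda>p. p c) \<in> gen_algebra"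
  using gen_monomial[of "{c}" 1 "\<lambda>_. 1"] by simp

lemma gen_inverse_coord: "(\<lambda>p. inverse (p c)) \<in> gen_algebra"
  using gen_monomial[of "{c}" 1 "\<lambda>_. -1"] by (simp add: power_int_minus)

lemma representative_uminus: "representative f \<Longrightarrow> representative (\<lambda>p. - f p)"
  using representative_mult[OF representative_gen[OF gen_const[of "-1"]], of f] by simp

lemma agree_uminus: "agree f f' \<Longrightarrow> agree (\<lambda>p. - f p) (\<lambda>p. - f' p)"
  unfolding agree_def by auto

lemma representative_diff:
  "representative f \<Longrightarrow> representative g \<Longrightarrow> representative (\<lambda>p. f p - g p)"
  using representative_add[OF _ representative_uminus, of f g] by simp

lemma agree_diff: "agree f f' \<Longrightarrow> agree g g' \<Longrightarrow> agree (\<lambda>p. f p - g p) (\<lambda>p. f' p - g' p)"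
  by (erule (1) agree_combine, erule agreeI) simp

quotient_type alg = "point \<Rightarrow> real" / partial: alg_rel
proof (rule part_equivpI)
  show "\<exists>f. alg_rel f f"
    using representative_gen[OF gen_const[of 0]] by (auto simp: alg_rel_def)
  show "symp alg_rel"
    unfolding symp_def alg_rel_def using agree_sym by blast
  show "transp alg_rel"
    unfolding transp_def alg_rel_def using agree_trans by blast
qed

instantiation alg :: comm_ring_1
begin

lift_definition zero_alg :: alg is "\<lambda>p. 0"
  using representative_gen[OF gen_const] by (simp add: alg_rel_def)

lift_definition one_alg :: alg is "\<lambda>p. 1"
  using representative_gen[OF gen_const] by (simp add: alg_rel_def)

lift_definition plus_alg :: "alg \<Rightarrow> alg \<Rightarrow> alg" is "\<lambda>f g p. f p + g p"
  by (auto simp: alg_rel_def intro: representative_add agree_add)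

lift_definition times_alg :: "alg \<Rightarrow> alg \<Rightarrow> alg" is "\<lambda>f g p. f p * g p"
  by (auto simp: alg_rel_def intro: representative_mult agree_mult)

lift_definition uminus_alg :: "alg \<Rightarrow> alg" is "\<lambda>f p. - f p"
  by (auto simp: alg_rel_def intro: representative_uminus agree_uminus)

lift_definition minus_alg :: "alg \<Rightarrow> alg \<Rightarrow> alg" is "\<lambda>f g p. f p - g p"
  by (auto simp: alg_rel_def intro: representative_diff agree_diff)

instance
proof
  fix a b c :: alg
  show "a * b * c = a * (b * c)"
    by transfer (auto simp: alg_rel_def algebra_simps intro: representative_mult)
  show "a * b = b * a"
    by transfer (auto simp: alg_rel_def algebra_simps intro: representative_mult)
  show "1 * a = a"
    by transfer (auto simp: alg_rel_def)
  show "a + b + c = a + (b + c)"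
    by transfer (auto simp: alg_rel_def algebra_simps intro: representative_add)
  show "a + b = b + a"
    by transfer (auto simp: alg_rel_def algebra_simps intro: representative_add)
  show "0 + a = a"
    by transfer (auto simp: alg_rel_def)
  show "- a + a = 0"
    by transfer (auto simp: alg_rel_def intro: representative_gen gen_const)
  show "a - b = a + - b"
    by transfer (auto simp: alg_rel_def intro: representative_diff)
  show "(a + b) * c = a * c + b * c"
    by transfer (auto simp: alg_rel_def algebra_simps
        intro!: representative_add representative_mult)
  show "(0::alg) \<noteq> 1"
  proof (transfer, rule notI)
    assume "alg_rel (\<lambda>p. 0) (\<lambda>p. 1)"
    then obtain S where "\<forall>p\<in>nonzero_on S. (0::real) = 1"
      unfolding alg_rel_def agree_def by blast
    moreover have "(\<lambda>_. 1) \<in> nonzero_on S"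
      by (simp add: nonzero_on_def)
    ultimately show False by auto
  qed
qed

end

instantiation alg :: real_algebra_1
begin

lift_definition scaleR_alg :: "real \<Rightarrow> alg \<Rightarrow> alg" is "\<lambda>a f p. a * f p"
  by (auto simp: alg_rel_def
      intro!: representative_mult agree_mult representative_gen[OF gen_const])

instance
proof
  fix a b :: real and x y :: alg
  show "a *\<^sub>R (x + y) = a *\<^sub>R x + a *\<^sub>R y"
    by transfer (auto simp: alg_rel_def algebra_simps
        intro!: representative_add representative_mult representative_gen[OF gen_const])
  show "(a + b) *\<^sub>R x = a *\<^sub>R x + b *\<^sub>R x"
    by transfer (auto simp: alg_rel_def algebra_simps
        intro!: representative_add representative_mult representative_gen[OF gen_const])
  show "a *\<^sub>R b *\<^sub>R x = (a * b) *\<^sub>R x"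
    by transfer (auto simp: alg_rel_def algebra_simps
        intro!: representative_mult representative_gen[OF gen_const])
  show "1 *\<^sub>R x = x"
    by transfer (auto simp: alg_rel_def)
  show "a *\<^sub>R x * y = a *\<^sub>R (x * y)"
    by transfer (auto simp: alg_rel_def algebra_simps
        intro!: representative_mult representative_gen[OF gen_const])
  show "x * a *\<^sub>R y = a *\<^sub>R (x * y)"
    by transfer (auto simp: alg_rel_def algebra_simps
        intro!: representative_mult representative_gen[OF gen_const])
qed

end

text \<open>The quotient \<open>a / b\<close> is only meaningful when \<open>b\<close> is a unit of the algebra.\<close>

instantiation alg :: inverse
begin

definition inverse_alg :: "alg \<Rightarrow> alg" where
  "inverse_alg a = (if a dvd 1 then THE b. a * b = 1 else 0)"

definition divide_alg :: "alg \<Rightarrow> alg \<Rightarrow> alg" where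
  "divide_alg a b = a * inverse b"

instance ..

end

lemma alg_inverse_unique:
  assumes "a * b = (1::alg)"
  shows "inverse a = b"
proof -
  have "(THE b. a * b = 1) = b"
  proof (rule the_equality[where P = "\<lambda>b. a * b = 1", OF assms])
    fix b' assume "a * b' = 1"
    have "b' = b' * (a * b)" using assms by simp
    also have "\<dots> = (a * b') * b" by (simp only: ac_simps)
    finally show "b' = b" using \<open>a * b' = 1\<close> by simp
  qed
  moreover have "a dvd 1" using assms by (metis dvd_triv_left)
  ultimately show ?thesis by (simp add: inverse_alg_def)
qed

lift_definition gen :: "coord \<Rightarrow> alg" is "\<lambda>c p. p c"
  by (simp add: alg_rel_def representative_gen gen_coord)

lift_definition gen_inv :: "coord \<Rightarrow> alg" is "\<lambda>c p. inverse (p c)"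
  by (simp add: alg_rel_def representative_gen gen_inverse_coord)

lemma gen_gen_inv: "gen c * gen_inv c = 1"
proof transfer
  fix c
  have "agree (\<lambda>p. p c * inverse (p c)) (\<lambda>p. 1)"
    unfolding agree_def by (rule exI[of _ "{c}"]) (simp add: nonzero_on_def)
  then show "alg_rel (\<lambda>p. p c * inverse (p c)) (\<lambda>p. 1)"
    unfolding alg_rel_def
    by (intro conjI representative_gen gen_algebra.mult gen_coord gen_inverse_coord gen_const)
qed

lemma inverse_gen: "inverse (gen c) = gen_inv c"
  by (rule alg_inverse_unique) (rule gen_gen_inv)

lemma gen_times_inverse [simp]: "gen c * inverse (gen c) = 1"
  by (simp add: inverse_gen gen_gen_inv)

lemma smooth_pd: "smooth_fun f \<Longrightarrow> smooth_fun (pd c f)"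
  unfolding smooth_fun_def
proof
  fix cs
  assume *: "\<forall>cs. continuous_on UNIV (foldr pd cs f) \<and>
               (\<forall>c p. (\<lambda>s. foldr pd cs f (p(c := s))) differentiable (at (p c)))"
  have "foldr pd (cs @ [c]) f = foldr pd cs (pd c f)" by simp
  then show "continuous_on UNIV (foldr pd cs (pd c f)) \<and>
      (\<forall>c' p. (\<lambda>s. foldr pd cs (pd c f) (p(c' := s))) differentiable (at (p c')))"
    using *[rule_format, of "cs @ [c]"] by simp
qed

lemma depends_only_on_mono: "depends_only_on S f \<Longrightarrow> S \<subseteq> S' \<Longrightarrow> depends_only_on S' f"
  unfolding depends_only_on_def by blast

lemma depends_only_on_upd: "depends_only_on S f \<Longrightarrow> c \<notin> S \<Longrightarrow> f (p(c := s)) = f p"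
  unfolding depends_only_on_def by auto

lemma depends_only_on_comb:
  assumes "depends_only_on S f" "depends_only_on S g"
  shows "depends_only_on S (\<lambda>p. h (f p) (g p))"
  unfolding depends_only_on_def
proof (intro allI impI)
  fix p p' :: point assume "\<forall>c\<in>S. p c = p' c"
  then have "f p = f p'" "g p = g p'"
    using assms unfolding depends_only_on_def by blast+
  then show "h (f p) (g p) = h (f p') (g p')" by simp
qed

lemma pd_eq_0: "depends_only_on S f \<Longrightarrow> c \<notin> S \<Longrightarrow> pd c f p = 0"
  unfolding pd_def by (simp add: depends_only_on_upd)

lemma depends_only_on_pd:
  assumes "depends_only_on S f"
  shows "depends_only_on S (pd c f)"
proof (cases "c \<in> S")
  case True
  show ?thesis unfolding depends_only_on_def
  proof (intro allI impI)
    fix p p' :: point assume *: "\<forall>c\<in>S. p c = p' c"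
    have "f (p(c := s)) = f (p'(c := s))" for s
      using assms * unfolding depends_only_on_def by simp
    then show "pd c f p = pd c f p'" using * True by (simp add: pd_def)
  qed
next
  case False
  then show ?thesis using pd_eq_0[OF assms] by (simp add: depends_only_on_def)
qed

lemma smooth_algebra_pd: "f \<in> smooth_algebra \<Longrightarrow> pd c f \<in> smooth_algebra"
  unfolding smooth_algebra_def using smooth_pd depends_only_on_pd by blast

definition tame :: "coord set \<Rightarrow> (point \<Rightarrow> real) \<Rightarrow> bool" where
  "tame S f \<longleftrightarrow> finite S \<and> depends_only_on S f \<and>
    (\<forall>c. \<exists>g\<in>gen_algebra. \<forall>p\<in>nonzero_on S.
       ((\<lambda>s. f (p(c := s))) has_real_derivative g p) (at (p c)))"

lemma tame_deriv:
  "tame S f \<Longrightarrow> \<exists>g\<in>gen_algebra. \<forall>p\<in>nonzero_on S.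
     ((\<lambda>s. f (p(c := s))) has_real_derivative g p) (at (p c))"
  by (simp add: tame_def)

lemma pd_eqI: "((\<lambda>s. f (p(c := s))) has_real_derivative d) (at (p c)) \<Longrightarrow> pd c f p = d"
  unfolding pd_def by (rule DERIV_imp_deriv)

lemma tame_mono:
  assumes "tame S f" "S \<subseteq> S'" "finite S'"
  shows "tame S' f"
proof -
  have "nonzero_on S' \<subseteq> nonzero_on S" using assms(2) by (auto simp: nonzero_on_def)
  then have "\<exists>g\<in>gen_algebra. \<forall>p\<in>nonzero_on S'.
      ((\<lambda>s. f (p(c := s))) has_real_derivative g p) (at (p c))" for c
    using tame_deriv[OF assms(1), of c] by blast
  moreover have "depends_only_on S' f"
    using assms(1,2) unfolding tame_def by (intro depends_only_on_mono[of S f S']) auto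
  ultimately show ?thesis unfolding tame_def
    using assms(3) by blast
qed

lemma tame_combine:
  assumes "\<exists>S. tame S f" "\<exists>S. tame S g"
  obtains S where "tame S f" "tame S g"
proof -
  from assms obtain S S' where *: "tame S f" "tame S' g" by blast
  then have "finite (S \<union> S')" by (simp add: tame_def)
  then have "tame (S \<union> S') f" "tame (S \<union> S') g" using * by (auto intro: tame_mono)
  then show ?thesis using that by blast
qed

lemma tame_in_gen_add:
  assumes "tame S f" "tame S g"
  shows "tame S (\<lambda>p. f p + g p)"
  unfolding tame_def
proof (intro conjI allI)
  show "finite S" using assms by (simp add: tame_def)
  show "depends_only_on S (\<lambda>p. f p + g p)"
    using assms by (intro depends_only_on_comb[where h = "(+)"]) (simp_all add: tame_def)
  fix c
  from assms obtain f' g' where f': "f' \<in> gen_algebra" "g' \<in> gen_algebra"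
    "\<And>p. p \<in> nonzero_on S \<Longrightarrow> ((\<lambda>s. f (p(c := s))) has_real_derivative f' p) (at (p c))"
    "\<And>p. p \<in> nonzero_on S \<Longrightarrow> ((\<lambda>s. g (p(c := s))) has_real_derivative g' p) (at (p c))"
    using tame_deriv[OF assms(1), of c] tame_deriv[OF assms(2), of c] by blast
  show "\<exists>h\<in>gen_algebra. \<forall>p\<in>nonzero_on S.
      ((\<lambda>s. f (p(c := s)) + g (p(c := s))) has_real_derivative h p) (at (p c))"
    by (rule bexI[of _ "\<lambda>p. f' p + g' p"]) (auto intro!: DERIV_add f' gen_algebra.add)
qed

lemma tame_in_gen_mult:
  assumes "tame S f" "tame S g" "f \<in> gen_algebra" "g \<in> gen_algebra"
  shows "tame S (\<lambda>p. f p * g p)"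
  unfolding tame_def
proof (intro conjI allI)
  show "finite S" using assms by (simp add: tame_def)
  show "depends_only_on S (\<lambda>p. f p * g p)"
    using assms by (intro depends_only_on_comb[where h = "(\<lambda>x y. x * y)"]) (simp_all add: tame_def)
  fix c
  from assms obtain f' g' where f': "f' \<in> gen_algebra" "g' \<in> gen_algebra"
    "\<And>p. p \<in> nonzero_on S \<Longrightarrow> ((\<lambda>s. f (p(c := s))) has_real_derivative f' p) (at (p c))"
    "\<And>p. p \<in> nonzero_on S \<Longrightarrow> ((\<lambda>s. g (p(c := s))) has_real_derivative g' p) (at (p c))"
    using tame_deriv[OF assms(1), of c] tame_deriv[OF assms(2), of c] by blast
  have "((\<lambda>s. f (p(c := s)) * g (p(c := s))) has_real_derivative f' p * g p + g' p * f p) (at (p c))"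
    if "p \<in> nonzero_on S" for p
    using DERIV_mult[OF f'(3)[OF that] f'(4)[OF that]] by simp
  then show "\<exists>h\<in>gen_algebra. \<forall>p\<in>nonzero_on S.
      ((\<lambda>s. f (p(c := s)) * g (p(c := s))) has_real_derivative h p) (at (p c))"
    by (intro bexI[of _ "\<lambda>p. f' p * g p + g' p * f p"])
      (auto intro!: gen_algebra.add gen_algebra.mult f' assms)
qed

lemma tame_const: "tame {} (\<lambda>p. a)"
  unfolding tame_def depends_only_on_def by (auto intro!: bexI[OF _ gen_const[of 0]])

lemma gen_powi: "(\<lambda>p. p c powi k) \<in> gen_algebra"
  using gen_monomial[of "{c}" 1 "\<lambda>_. k"] by simp

lemma tame_powi: "tame {c} (\<lambda>p. p c powi k)"
  unfolding tame_def
proof (intro conjI allI)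
  fix c'
  have a: "(\<lambda>p. (if c' = c then of_int k else 0) * p c powi (k - 1)) \<in> gen_algebra"
    by (intro gen_algebra.mult gen_const gen_powi)
  have b: "((\<lambda>s. (p(c' := s)) c powi k) has_real_derivative
      (if c' = c then of_int k else 0) * p c powi (k - 1)) (at (p c'))"
    if "p \<in> nonzero_on {c}" for p
    using that by (auto simp: nonzero_on_def intro!: derivative_eq_intros)
  show "\<exists>g\<in>gen_algebra. \<forall>p\<in>nonzero_on {c}.
      ((\<lambda>s. (p(c' := s)) c powi k) has_real_derivative g p) (at (p c'))"
    by (rule bexI[OF _ a], rule ballI, rule b)
qed (auto simp: depends_only_on_def)

lemma tame_prod:
  "finite S \<Longrightarrow> (\<lambda>p. \<Prod>c\<in>S. p c powi e c) \<in> gen_algebra \<and> (\<exists>S'. tame S' (\<lambda>p. \<Prod>c\<in>S. p c powi e c))"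
proof (induction S rule: finite_induct)
  case empty
  then show ?case using tame_const[of 1] gen_const[of 1] by auto
next
  case (insert c S)
  define g where "g = (\<lambda>p :: point. \<Prod>c\<in>S. p c powi e c)"
  have IH: "g \<in> gen_algebra" "\<exists>S'. tame S' g" using insert.IH by (auto simp: g_def)
  have "\<exists>S'. tame S' (\<lambda>p. p c powi e c)" using tame_powi by blast
  then obtain S' where S': "tame S' (\<lambda>p. p c powi e c)" "tame S' g"
    using IH(2) by (rule tame_combine)
  have eq: "(\<lambda>p. \<Prod>c\<in>insert c S. p c powi e c) = (\<lambda>p. p c powi e c * g p)"
    using insert.hyps by (simp add: g_def)
  show ?case unfolding eq
    using tame_in_gen_mult[OF S' gen_powi IH(1)] gen_algebra.mult[OF gen_powi IH(1)] by blast
qed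

lemma tame_sum:
  "finite I \<Longrightarrow> (\<And>i. i \<in> I \<Longrightarrow> \<exists>S. tame S (f i)) \<Longrightarrow> \<exists>S. tame S (\<lambda>p. \<Sum>i\<in>I. f i p)"
proof (induction I rule: finite_induct)
  case empty
  then show ?case using tame_const[of 0] by auto
next
  case (insert i I)
  then have "\<exists>S. tame S (f i)" "\<exists>S. tame S (\<lambda>p. \<Sum>i\<in>I. f i p)" by auto
  then obtain S where "tame S (f i)" "tame S (\<lambda>p. \<Sum>i\<in>I. f i p)"
    by (rule tame_combine)
  then show ?case using insert tame_in_gen_add[of S "f i" "\<lambda>p. \<Sum>i\<in>I. f i p"] by auto
qed

lemma tame_laurent: "f \<in> laurent_algebra \<Longrightarrow> \<exists>S. tame S f"
proof -
  assume "f \<in> laurent_algebra"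
  then obtain I :: "nat set" and S a e where fin: "finite I" "finite S"
    and f: "f = (\<lambda>p. \<Sum>i\<in>I. a i * (\<Prod>c\<in>S. p c powi e i c))"
    unfolding laurent_algebra_def by blast
  have "\<exists>S'. tame S' (\<lambda>p. a i * (\<Prod>c\<in>S. p c powi e i c))" for i
  proof -
    define g where "g = (\<lambda>p :: point. \<Prod>c\<in>S. p c powi e i c)"
    have g: "g \<in> gen_algebra" "\<exists>S'. tame S' g" using tame_prod[OF fin(2)] by (auto simp: g_def)
    have "\<exists>S'. tame S' (\<lambda>p. a i)" using tame_const by blast
    then obtain S' where S': "tame S' (\<lambda>p. a i)" "tame S' g"
      using g(2) by (rule tame_combine)
    show ?thesis using tame_in_gen_mult[OF S' gen_const g(1)] by (auto simp: g_def)
  qed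
  then show ?thesis unfolding f by (intro tame_sum[OF fin(1)])
qed

lemma tame_smooth:
  assumes "f \<in> smooth_algebra"
  shows "\<exists>S. tame S f"
proof -
  from assms obtain S where S: "finite S" "depends_only_on S f"
    unfolding smooth_algebra_def by blast
  have "((\<lambda>s. f (p(c := s))) has_real_derivative pd c f p) (at (p c))" for c p
  proof -
    have "smooth_fun f" using assms by (simp add: smooth_algebra_def)
    then have "(\<lambda>s. f (p(c := s))) differentiable (at (p c))"
      unfolding smooth_fun_def by (metis foldr_Nil id_apply)
    then show ?thesis unfolding pd_def by (simp add: DERIV_deriv_iff_real_differentiable)
  qed
  then have "tame S f"
    unfolding tame_def using S smooth_algebra_pd[OF assms] gen_algebra.base by blast
  then show ?thesis ..
qed

lemma tame_gen: "f \<in> gen_algebra \<Longrightarrow> \<exists>S. tame S f"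
proof (induction rule: gen_algebra.induct)
  case (base f)
  then show ?case using tame_laurent tame_smooth by blast
next
  case (add f g)
  from add.IH obtain S where "tame S f" "tame S g" by (rule tame_combine)
  then show ?case using tame_in_gen_add by blast
next
  case (mult f g)
  from mult.IH obtain S where "tame S f" "tame S g" by (rule tame_combine)
  then show ?case using tame_in_gen_mult mult.hyps by blast
qed

lemma eventually_nonzero_on:
  assumes "p \<in> nonzero_on S"
  shows "\<forall>\<^sub>F s in nhds (p c). p(c := s) \<in> nonzero_on S"
proof (cases "p c = 0")
  case True
  then have "c \<notin> S" using assms by (auto simp: nonzero_on_def)
  then show ?thesis using assms by (auto simp: nonzero_on_def intro!: always_eventually)
next
  case False
  then have "\<forall>\<^sub>F s in nhds (p c). s \<noteq> 0"
    by (intro t1_space_nhds)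
  then show ?thesis by (rule eventually_mono) (use assms in \<open>auto simp: nonzero_on_def\<close>)
qed

text \<open>Off the zero set of finitely many coordinates, representatives behave like smooth functions.\<close>

definition regular :: "coord set \<Rightarrow> (point \<Rightarrow> real) \<Rightarrow> bool" where
  "regular S f \<longleftrightarrow> finite S \<and>
    (\<forall>c. \<forall>p\<in>nonzero_on S.
       ((\<lambda>s. f (p(c := s))) has_real_derivative pd c f p) (at (p c))) \<and>
    (\<forall>c. c \<notin> S \<longrightarrow> (\<forall>p\<in>nonzero_on S. pd c f p = 0)) \<and>
    (\<forall>c. representative (pd c f))"

lemma representative_regular:
  assumes "representative f"
  shows "\<exists>S. regular S f"
proof -
  from assms obtain g S1 where g: "g \<in> gen_algebra" "finite S1" "\<forall>p\<in>nonzero_on S1. f p = g p"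
    unfolding representative_def agree_def by blast
  from tame_gen[OF g(1)] obtain S2 where S2: "tame S2 g" by blast
  define S where "S = S1 \<union> S2"
  have fin: "finite S" using g S2 by (simp add: S_def tame_def)
  have S: "tame S g" by (rule tame_mono[OF S2]) (use fin in \<open>auto simp: S_def\<close>)
  have fg: "f p = g p" if "p \<in> nonzero_on S" for p
    using that g by (simp add: S_def nonzero_on_Un)
  have ev: "\<forall>\<^sub>F s in nhds (p c). f (p(c := s)) = g (p(c := s))" if "p \<in> nonzero_on S" for p c
    using eventually_nonzero_on[OF that] by (rule eventually_mono) (rule fg)
  have "\<exists>g'\<in>gen_algebra. \<forall>p\<in>nonzero_on S. pd c f p = g' p \<and>
      ((\<lambda>s. f (p(c := s))) has_real_derivative pd c f p) (at (p c))" for c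
  proof -
    from S obtain g' where g': "g' \<in> gen_algebra"
      "\<And>p. p \<in> nonzero_on S \<Longrightarrow> ((\<lambda>s. g (p(c := s))) has_real_derivative g' p) (at (p c))"
      using tame_deriv[OF S, of c] by blast
    have *: "((\<lambda>s. f (p(c := s))) has_real_derivative g' p) (at (p c))" if "p \<in> nonzero_on S" for p
      using DERIV_cong_ev[OF refl ev[OF that] refl] g'(2)[OF that] by blast
    have "pd c f p = g' p" if "p \<in> nonzero_on S" for p
      by (rule pd_eqI) (rule *[OF that])
    then show ?thesis using * by (intro bexI[OF _ g'(1)]) simp
  qed
  note d = this
  have "((\<lambda>s. f (p(c := s))) has_real_derivative pd c f p) (at (p c))"
    if "p \<in> nonzero_on S" for c p
    using d[of c] that by blast
  moreover have "pd c f p = 0" if "c \<notin> S" "p \<in> nonzero_on S" for c p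
  proof -
    have "pd c f p = pd c g p"
      unfolding pd_def by (rule deriv_cong_ev[OF ev[OF that(2)] refl])
    then show ?thesis using pd_eq_0[of S g c p] S that by (simp add: tame_def)
  qed
  moreover have "representative (pd c f)" for c
    using d[of c] fin unfolding representative_def agree_def by blast
  ultimately have "regular S f" using fin by (simp add: regular_def)
  then show ?thesis ..
qed

lemma agree_pd:
  assumes "agree f g"
  shows "agree (pd c f) (pd c g)"
proof -
  from assms obtain S where S: "finite S" "\<forall>p\<in>nonzero_on S. f p = g p"
    unfolding agree_def by blast
  show ?thesis
  proof (rule agreeI[OF S(1)])
    fix p assume p: "p \<in> nonzero_on S"
    have "\<forall>\<^sub>F s in nhds (p c). f (p(c := s)) = g (p(c := s))"
      using eventually_nonzero_on[OF p] by (rule eventually_mono) (use S in blast)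
    then show "pd c f p = pd c g p" unfolding pd_def by (rule deriv_cong_ev) simp
  qed
qed

lemma representative_pd: "representative f \<Longrightarrow> representative (pd c f)"
  using representative_regular by (auto simp: regular_def)

lift_definition pdiff :: "coord \<Rightarrow> alg \<Rightarrow> alg" is pd
  by (auto simp: alg_rel_def intro: representative_pd agree_pd)

lemma pdiff_finite: "finite {c. pdiff c a \<noteq> 0}"
proof -
  have "\<exists>S. finite S \<and> (\<forall>c. c \<notin> S \<longrightarrow> pdiff c a = 0)"
  proof transfer
    fix f assume "alg_rel f f"
    then have f: "representative f" by (simp add: alg_rel_def)
    obtain S where "regular S f" using representative_regular[OF f] ..
    then have S: "finite S" "\<And>c p. c \<notin> S \<Longrightarrow> p \<in> nonzero_on S \<Longrightarrow> pd c f p = 0"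
      by (auto simp: regular_def)
    have "alg_rel (pd c f) (\<lambda>p. 0)" if "c \<notin> S" for c
      unfolding alg_rel_def using f S that
      by (auto intro: representative_pd representative_gen gen_const agreeI)
    with S(1) show "\<exists>S. finite S \<and> (\<forall>c. c \<notin> S \<longrightarrow> alg_rel (pd c f) (\<lambda>p. 0))" by blast
  qed
  then show ?thesis by (metis (mono_tags, lifting) finite_subset mem_Collect_eq subsetI)
qed

text \<open>The derivation with components \<open>v c\<close>; the sum is finite by \<open>pdiff_finite\<close>.\<close>

definition vfield :: "(coord \<Rightarrow> alg) \<Rightarrow> alg \<Rightarrow> alg" where
  "vfield v a = (\<Sum>c | pdiff c a \<noteq> 0. v c * pdiff c a)"

lemma representative_regular2:
  assumes "representative f" "representative g"
  shows "\<exists>S. regular S f \<and> regular S g"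
proof -
  obtain S where S: "regular S f" using representative_regular[OF assms(1)] ..
  obtain S' where S': "regular S' g" using representative_regular[OF assms(2)] ..
  have "regular (S \<union> S') f \<and> regular (S \<union> S') g"
    using S S' by (simp add: regular_def nonzero_on_Un)
  then show ?thesis ..
qed

lemma pdiff_add: "pdiff c (a + b) = pdiff c a + pdiff c b"
proof transfer
  fix c f g assume "alg_rel f f" "alg_rel g g"
  then have rep: "representative f" "representative g" by (auto simp: alg_rel_def)
  obtain S where "regular S f" "regular S g"
    using representative_regular2[OF rep] by blast
  then have S: "finite S"
    "\<And>c p. p \<in> nonzero_on S \<Longrightarrow>
       ((\<lambda>s. f (p(c := s))) has_real_derivative pd c f p) (at (p c))"
    "\<And>c p. p \<in> nonzero_on S \<Longrightarrow>
       ((\<lambda>s. g (p(c := s))) has_real_derivative pd c g p) (at (p c))"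
    by (simp_all add: regular_def)
  have "agree (pd c (\<lambda>p. f p + g p)) (\<lambda>p. pd c f p + pd c g p)"
    by (rule agreeI[OF S(1)], rule pd_eqI, rule DERIV_add) (rule S, assumption)+
  then show "alg_rel (pd c (\<lambda>p. f p + g p)) (\<lambda>p. pd c f p + pd c g p)"
    unfolding alg_rel_def by (intro conjI representative_pd representative_add rep)
qed

lemma pdiff_mult: "pdiff c (a * b) = pdiff c a * b + a * pdiff c b"
proof transfer
  fix c f g assume "alg_rel f f" "alg_rel g g"
  then have rep: "representative f" "representative g" by (auto simp: alg_rel_def)
  obtain S where "regular S f" "regular S g"
    using representative_regular2[OF rep] by blast
  then have S: "finite S"
    "\<And>c p. p \<in> nonzero_on S \<Longrightarrow>
       ((\<lambda>s. f (p(c := s))) has_real_derivative pd c f p) (at (p c))"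
    "\<And>c p. p \<in> nonzero_on S \<Longrightarrow>
       ((\<lambda>s. g (p(c := s))) has_real_derivative pd c g p) (at (p c))"
    by (simp_all add: regular_def)
  have "agree (pd c (\<lambda>p. f p * g p)) (\<lambda>p. pd c f p * g p + f p * pd c g p)"
  proof (rule agreeI[OF S(1)], rule pd_eqI)
    fix p assume p: "p \<in> nonzero_on S"
    show "((\<lambda>s. f (p(c := s)) * g (p(c := s))) has_real_derivative
        pd c f p * g p + f p * pd c g p) (at (p c))"
      using DERIV_mult[OF S(2)[OF p] S(3)[OF p], of c] by (simp add: mult.commute)
  qed
  then show "alg_rel (pd c (\<lambda>p. f p * g p)) (\<lambda>p. pd c f p * g p + f p * pd c g p)"
    unfolding alg_rel_def
    by (intro conjI representative_pd representative_add representative_mult rep)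
qed

lemma pdiff_gen: "pdiff c (gen c') = (if c = c' then 1 else 0)"
proof -
  have eq: "pd c (\<lambda>p. p c') = (\<lambda>p. if c = c' then 1 else 0)" for c c'
    by (auto simp: pd_def)
  have "pdiff c (gen c) = 1"
    by transfer (simp add: eq alg_rel_def representative_gen gen_const)
  moreover have "c \<noteq> c' \<Longrightarrow> pdiff c (gen c') = 0"
    by transfer (simp add: eq alg_rel_def representative_gen gen_const)
  ultimately show ?thesis by (cases "c = c'") auto
qed

lemma pdiff_0 [simp]: "pdiff c 0 = 0"
  using pdiff_add[of c 0 0] by simp

lemma pdiff_1 [simp]: "pdiff c 1 = 0"
  using pdiff_mult[of c 1 1] by simp

lemma vfield_superset:
  assumes "finite S" "{c. pdiff c a \<noteq> 0} \<subseteq> S"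
  shows "vfield v a = (\<Sum>c\<in>S. v c * pdiff c a)"
  unfolding vfield_def by (rule sum.mono_neutral_left) (use assms in auto)

lemma vfield_add: "vfield v (a + b) = vfield v a + vfield v b"
proof -
  let ?S = "{c. pdiff c a \<noteq> 0} \<union> {c. pdiff c b \<noteq> 0}"
  have fin: "finite ?S" by (simp add: pdiff_finite)
  have "vfield v x = (\<Sum>c\<in>?S. v c * pdiff c x)" if "x \<in> {a, b, a + b}" for x
    by (rule vfield_superset[OF fin]) (use that in \<open>auto simp: pdiff_add\<close>)
  then show ?thesis by (simp add: pdiff_add distrib_left sum.distrib)
qed

lemma vfield_mult: "vfield v (a * b) = vfield v a * b + a * vfield v b"
proof -
  let ?S = "{c. pdiff c a \<noteq> 0} \<union> {c. pdiff c b \<noteq> 0}"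
  have fin: "finite ?S" by (simp add: pdiff_finite)
  have "vfield v x = (\<Sum>c\<in>?S. v c * pdiff c x)" if "x \<in> {a, b, a * b}" for x
    by (rule vfield_superset[OF fin]) (use that in \<open>auto simp: pdiff_mult\<close>)
  then show ?thesis
    by (simp add: pdiff_mult sum_distrib_left sum_distrib_right algebra_simps flip: sum.distrib)
qed

lemma vfield_gen [simp]: "vfield v (gen c) = v c"
  using vfield_superset[of "{c}" "gen c" v] by (simp add: pdiff_gen)

lemma vfield_0 [simp]: "vfield v 0 = 0"
  by (simp add: vfield_def)

lemma vfield_1 [simp]: "vfield v 1 = 0"
  by (simp add: vfield_def)

lemma vfield_uminus: "vfield v (- a) = - vfield v a"
  using vfield_add[of v a "- a"] by (simp add: eq_neg_iff_add_eq_0 add.commute)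

lemma vfield_diff: "vfield v (a - b) = vfield v a - vfield v b"
  using vfield_add[of v a "- b"] by (simp add: vfield_uminus)

lemma vfield_gen_inverse: "vfield v (inverse (gen c)) = - v c * inverse (gen c) * inverse (gen c)"
proof -
  let ?i = "inverse (gen c)"
  have "vfield v (gen c * ?i) = 0" by simp
  then have "gen c * vfield v ?i = - (v c * ?i)"
    by (simp only: vfield_mult vfield_gen) (simp add: eq_neg_iff_add_eq_0 add.commute)
  then have "?i * (gen c * vfield v ?i) = - v c * ?i * ?i" by simp
  moreover have "?i * (gen c * vfield v ?i) = (gen c * ?i) * vfield v ?i" by (simp only: ac_simps)
  ultimately show ?thesis by simp
qed

fun prev :: "(nat \<Rightarrow> 'a::zero) \<Rightarrow> nat \<Rightarrow> 'a" where
  "prev f 0 = 0"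
| "prev f (Suc \<alpha>) = f \<alpha>"

abbreviation z_el :: alg where "z_el \<equiv> gen cZ"
abbreviation t_el :: alg where "t_el \<equiv> gen cT"

abbreviation u_el :: "nat \<Rightarrow> nat \<Rightarrow> alg" where "u_el i j \<equiv> gen (cU i j)"

fun uy_el :: "nat \<Rightarrow> nat \<Rightarrow> nat \<Rightarrow> alg" where
  "uy_el i 0 j = gen (cU i j)"
| "uy_el i (Suc k) j = gen (cUY i k j)"

fun uz_el :: "nat \<Rightarrow> nat \<Rightarrow> nat \<Rightarrow> alg" where
  "uz_el i 0 j = gen (cU i j)"
| "uz_el i (Suc l) j = gen (cUZ i l j)"

abbreviation q_el :: "nat \<Rightarrow> nat \<Rightarrow> nat \<Rightarrow> alg" where "q_el \<alpha> a b \<equiv> gen (cQ \<alpha> a b)"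
abbreviation m_el :: "nat \<Rightarrow> nat \<Rightarrow> nat \<Rightarrow> alg" where "m_el \<alpha> a b \<equiv> gen (cM \<alpha> a b)"

fun r_el :: "nat \<Rightarrow> alg" where
  "r_el 0 = - u_el 0 0"
| "r_el (Suc \<beta>) = gen (cR \<beta> 0 0)"

abbreviation u_x :: alg where "u_x \<equiv> u_el 1 0"
abbreviation u_xx :: alg where "u_xx \<equiv> u_el 2 0"
abbreviation u_tx :: alg where "u_tx \<equiv> u_el 1 1"
abbreviation u_z :: alg where "u_z \<equiv> uz_el 0 1 0"
abbreviation u_xz :: alg where "u_xz \<equiv> uz_el 1 1 0"

definition G_el :: alg where
  "G_el = u_tx - u_z * u_xx + u_x * u_xz"

text \<open>
  The components of the four total derivatives refer to iterated total derivatives. To make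
  this recursion explicit, \<open>px\<close>, \<open>pz\<close> and \<open>pt\<close> give the components of the total derivatives with
  respect to \<open>x\<close>, \<open>z\<close> and \<open>t\<close> only on those coordinates on which they raise an index, and 0 (never
  used) elsewhere. The resulting \<open>Dx\<close>, \<open>Dy\<close>, \<open>Dz\<close>, \<open>Dt\<close> satisfy the usual defining
  equations, in which only these four occur: see \<open>total_derivatives_u\<close>, \<open>total_derivatives_q\<close>,
  \<open>total_derivatives_m\<close> and \<open>total_derivatives_r\<close>.
\<close>

fun px :: "coord \<Rightarrow> alg" where
  "px cX = 1"
| "px (cU i j) = gen (cU (Suc i) j)"
| "px (cUY i k j) = gen (cUY (Suc i) k j)"
| "px (cUZ i l j) = gen (cUZ (Suc i) l j)"
| "px (cQ \<alpha> a b) = gen (cQ \<alpha> (Suc a) b)"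
| "px (cM \<alpha> a b) = gen (cM \<alpha> (Suc a) b)"
| "px _ = 0"

fun pz :: "coord \<Rightarrow> alg" where
  "pz cZ = 1"
| "pz (cU i j) = gen (cUZ i 0 j)"
| "pz (cUZ i l j) = gen (cUZ i (Suc l) j)"
| "pz (cQ \<alpha> a b) = gen (cQ \<alpha> a (Suc b))"
| "pz (cM \<alpha> a b) = gen (cM \<alpha> a (Suc b))"
| "pz _ = 0"

fun pt :: "coord \<Rightarrow> alg" where
  "pt cT = 1"
| "pt (cU i j) = gen (cU i (Suc j))"
| "pt (cUY i k j) = gen (cUY i k (Suc j))"
| "pt (cUZ i l j) = gen (cUZ i l (Suc j))"
| "pt _ = 0"

fun vy :: "coord \<Rightarrow> alg" where
  "vy cX = 0"
| "vy cY = 1"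
| "vy cZ = 0"
| "vy cT = 0"
| "vy (cU i j) = gen (cUY i 0 j)"
| "vy (cUY i k j) = gen (cUY i (Suc k) j)"
| "vy (cUZ i l j) = (vfield px ^^ i) ((vfield pz ^^ l) ((vfield pt ^^ j) G_el))"
| "vy (cQ \<alpha> a b) = (vfield px ^^ a) ((vfield pz ^^ b)
     (u_x * q_el \<alpha> 1 0 + prev (\<lambda>\<gamma>. q_el \<gamma> 1 0) \<alpha>))"
| "vy (cM \<alpha> a b) = (vfield px ^^ a) ((vfield pz ^^ b)
     (u_x * m_el \<alpha> 1 0 - z_el / t_el * m_el \<alpha> 1 0 - 1 / t_el * prev (\<lambda>\<gamma>. m_el \<gamma> 1 0) \<alpha>))"
| "vy (cR \<beta> a b) = gen (cR \<beta> (Suc a) b)"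

fun vt :: "coord \<Rightarrow> alg" where
  "vt cX = 0"
| "vt cY = 0"
| "vt cZ = 0"
| "vt cT = 1"
| "vt (cU i j) = gen (cU i (Suc j))"
| "vt (cUY i k j) = gen (cUY i k (Suc j))"
| "vt (cUZ i l j) = gen (cUZ i l (Suc j))"
| "vt (cQ \<alpha> a b) = (vfield px ^^ a) ((vfield pz ^^ b)
     (u_z * q_el \<alpha> 1 0 + prev (\<lambda>\<gamma>. q_el \<gamma> 0 1) \<alpha>))"
| "vt (cM \<alpha> a b) = (vfield px ^^ a) ((vfield pz ^^ b)
     (u_z * m_el \<alpha> 1 0 - z_el / t_el * m_el \<alpha> 0 1 - 1 / t_el * prev (\<lambda>\<gamma>. m_el \<gamma> 0 1) \<alpha>))"
| "vt (cR \<beta> a b) = gen (cR \<beta> a (Suc b))"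

definition Dy :: "alg \<Rightarrow> alg" where "Dy = vfield vy"
definition Dt :: "alg \<Rightarrow> alg" where "Dt = vfield vt"

fun Dx_r :: "nat \<Rightarrow> alg" where
  "Dx_r 0 = - u_x"
| "Dx_r (Suc \<beta>) = u_x * Dx_r \<beta> - Dy (r_el \<beta>)"

fun vx :: "coord \<Rightarrow> alg" where
  "vx cX = 1"
| "vx cY = 0"
| "vx cZ = 0"
| "vx cT = 0"
| "vx (cU i j) = gen (cU (Suc i) j)"
| "vx (cUY i k j) = gen (cUY (Suc i) k j)"
| "vx (cUZ i l j) = gen (cUZ (Suc i) l j)"
| "vx (cQ \<alpha> a b) = gen (cQ \<alpha> (Suc a) b)"
| "vx (cM \<alpha> a b) = gen (cM \<alpha> (Suc a) b)"
| "vx (cR \<beta> a b) = (Dy ^^ a) ((Dt ^^ b) (u_x * Dx_r \<beta> - Dy (r_el \<beta>)))"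

fun vz :: "coord \<Rightarrow> alg" where
  "vz cX = 0"
| "vz cY = 0"
| "vz cZ = 1"
| "vz cT = 0"
| "vz (cU i j) = gen (cUZ i 0 j)"
| "vz (cUY i k j) = (vfield px ^^ i) ((Dy ^^ k) ((Dt ^^ j) G_el))"
| "vz (cUZ i l j) = gen (cUZ i (Suc l) j)"
| "vz (cQ \<alpha> a b) = gen (cQ \<alpha> a (Suc b))"
| "vz (cM \<alpha> a b) = gen (cM \<alpha> a (Suc b))"
| "vz (cR \<beta> a b) = (Dy ^^ a) ((Dt ^^ b) (u_z * Dx_r \<beta> - Dt (r_el \<beta>)))"

definition Dx :: "alg \<Rightarrow> alg" where "Dx = vfield vx"
definition Dz :: "alg \<Rightarrow> alg" where "Dz = vfield vz"

inductive_set subalg :: "alg set \<Rightarrow> alg set" for B where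
  subalg_base: "b \<in> B \<Longrightarrow> b \<in> subalg B"
| subalg_0: "0 \<in> subalg B"
| subalg_1: "1 \<in> subalg B"
| subalg_uminus: "a \<in> subalg B \<Longrightarrow> - a \<in> subalg B"
| subalg_add: "a \<in> subalg B \<Longrightarrow> b \<in> subalg B \<Longrightarrow> a + b \<in> subalg B"
| subalg_mult: "a \<in> subalg B \<Longrightarrow> b \<in> subalg B \<Longrightarrow> a * b \<in> subalg B"

lemma subalg_diff: "a \<in> subalg B \<Longrightarrow> b \<in> subalg B \<Longrightarrow> a - b \<in> subalg B"
  using subalg_add[OF _ subalg_uminus, of a B b] by simp

lemma subalg_mono:
  assumes "a \<in> subalg B" "\<And>b. b \<in> B \<Longrightarrow> b \<in> B'"
  shows "a \<in> subalg B'"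
  using assms(1) by induction (auto intro: subalg.intros assms(2))

lemma vfield_agree:
  assumes "a \<in> subalg B" "\<And>b. b \<in> B \<Longrightarrow> vfield v b = vfield w b"
  shows "vfield v a = vfield w a"
  using assms(1) by induction (simp_all add: assms(2) vfield_add vfield_mult vfield_uminus)

lemma vfield_closed:
  assumes "a \<in> subalg B" "\<And>b. b \<in> B \<Longrightarrow> vfield w b \<in> subalg B"
  shows "vfield w a \<in> subalg B"
  using assms(1)
proof induction
  case (subalg_mult a b)
  then show ?case by (simp add: vfield_mult subalg.subalg_add subalg.subalg_mult)
qed (auto simp: assms(2) vfield_add vfield_uminus intro: subalg.intros)

lemma vfield_pow_agree:
  assumes "\<And>b. b \<in> B \<Longrightarrow> vfield v b = vfield w b"
    and "\<And>b. b \<in> B \<Longrightarrow> vfield w b \<in> subalg B" and "a \<in> subalg B"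
  shows "(vfield w ^^ n) a = (vfield v ^^ n) a \<and> (vfield v ^^ n) a \<in> subalg B"
proof (induction n)
  case (Suc n)
  then show ?case using vfield_agree[of "(vfield v ^^ n) a" B v w]
      vfield_closed[of "(vfield v ^^ n) a" B w] assms by simp
qed (use assms in simp)

lemma vfield_pow_closed:
  assumes "\<And>b. b \<in> B \<Longrightarrow> vfield w b \<in> subalg B" "a \<in> subalg B"
  shows "(vfield w ^^ n) a \<in> subalg B"
  using vfield_pow_agree[OF refl assms] by simp

inductive_set B_xzt :: "alg set" where
  "gen (cU i j) \<in> B_xzt"
| "gen (cUZ i l j) \<in> B_xzt"

inductive_set B_xyzt :: "alg set" where
  "gen (cU i j) \<in> B_xyzt"
| "gen (cUY i k j) \<in> B_xyzt"
| "gen (cUZ i l j) \<in> B_xyzt"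

inductive_set B_qm :: "alg set" where
  "gen cZ \<in> B_qm"
| "inverse (gen cT) \<in> B_qm"
| "gen (cU i j) \<in> B_qm"
| "gen (cUZ i l j) \<in> B_qm"
| "gen (cQ \<alpha> a b) \<in> B_qm"
| "gen (cM \<alpha> a b) \<in> B_qm"

lemma B_xzt_B_xyzt: "b \<in> B_xzt \<Longrightarrow> b \<in> B_xyzt"
  by (auto elim!: B_xzt.cases intro: B_xyzt.intros)

lemma G_el_subalg: "G_el \<in> subalg B_xzt"
  unfolding G_el_def One_nat_def uz_el.simps
  by (intro subalg_diff subalg_add subalg_mult subalg_base B_xzt.intros)

lemma Dy_uz: "Dy (uz_el i (Suc l) j) = (Dx ^^ i) ((Dz ^^ l) ((Dt ^^ j) G_el))"
proof -
  have t: "(vfield pt ^^ n) a = (Dt ^^ n) a \<and> (Dt ^^ n) a \<in> subalg B_xzt"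
    if "a \<in> subalg B_xzt" for n a
    unfolding Dt_def using that
    by (intro vfield_pow_agree) (auto elim!: B_xzt.cases intro!: subalg_base B_xzt.intros)
  have z: "(vfield pz ^^ n) a = (Dz ^^ n) a \<and> (Dz ^^ n) a \<in> subalg B_xzt"
    if "a \<in> subalg B_xzt" for n a
    unfolding Dz_def using that
    by (intro vfield_pow_agree) (auto elim!: B_xzt.cases intro!: subalg_base B_xzt.intros)
  have x: "(vfield px ^^ n) a = (Dx ^^ n) a \<and> (Dx ^^ n) a \<in> subalg B_xzt"
    if "a \<in> subalg B_xzt" for n a
    unfolding Dx_def using that
    by (intro vfield_pow_agree) (auto elim!: B_xzt.cases intro!: subalg_base B_xzt.intros)
  have "Dy (uz_el i (Suc l) j) = (vfield px ^^ i) ((vfield pz ^^ l) ((vfield pt ^^ j) G_el))"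
    by (simp add: Dy_def)
  then show ?thesis using t[OF G_el_subalg] z x by simp
qed

lemma vy_uz_subalg: "vy (cUZ i l j) \<in> subalg B_xzt"
proof -
  have t: "(vfield pt ^^ n) a \<in> subalg B_xzt" if "a \<in> subalg B_xzt" for n a
    using that by (intro vfield_pow_closed) (auto elim!: B_xzt.cases intro!: subalg_base B_xzt.intros)
  have z: "(vfield pz ^^ n) a \<in> subalg B_xzt" if "a \<in> subalg B_xzt" for n a
    using that by (intro vfield_pow_closed) (auto elim!: B_xzt.cases intro!: subalg_base B_xzt.intros)
  have x: "(vfield px ^^ n) a \<in> subalg B_xzt" if "a \<in> subalg B_xzt" for n a
    using that by (intro vfield_pow_closed) (auto elim!: B_xzt.cases intro!: subalg_base B_xzt.intros)
  show ?thesis by (simp add: t z x G_el_subalg)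
qed

lemma Dz_uy: "Dz (uy_el i (Suc k) j) = (Dx ^^ i) ((Dy ^^ k) ((Dt ^^ j) G_el))"
proof -
  have G: "G_el \<in> subalg B_xyzt"
    by (rule subalg_mono[OF G_el_subalg]) (rule B_xzt_B_xyzt)
  have uz: "vy (cUZ i l j) \<in> subalg B_xyzt" for i l j
    by (rule subalg_mono[OF vy_uz_subalg]) (rule B_xzt_B_xyzt)
  have t: "(Dt ^^ n) a \<in> subalg B_xyzt" if "a \<in> subalg B_xyzt" for n a
    unfolding Dt_def using that
    by (intro vfield_pow_closed) (auto elim!: B_xyzt.cases intro!: subalg_base B_xyzt.intros)
  have "vfield vy b \<in> subalg B_xyzt" if "b \<in> B_xyzt" for b
  proof -
    from that consider i j where "b = gen (cU i j)" | i k j where "b = gen (cUY i k j)"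
      | i l j where "b = gen (cUZ i l j)"
      by cases auto
    then show ?thesis
    proof cases
      case 3
      then show ?thesis using uz by (simp del: vy.simps)
    qed (auto intro!: subalg_base B_xyzt.intros)
  qed
  then have y: "(Dy ^^ n) a \<in> subalg B_xyzt" if "a \<in> subalg B_xyzt" for n a
    unfolding Dy_def using that by (intro vfield_pow_closed)
  have x: "(vfield px ^^ n) a = (Dx ^^ n) a" if "a \<in> subalg B_xyzt" for n a
    unfolding Dx_def using that
    by (intro conjunct1[OF vfield_pow_agree])
      (auto elim!: B_xyzt.cases intro!: subalg_base B_xyzt.intros)
  have "Dz (uy_el i (Suc k) j) = (vfield px ^^ i) ((Dy ^^ k) ((Dt ^^ j) G_el))"
    by (simp add: Dz_def)
  then show ?thesis by (simp add: x y t G)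
qed

lemma pow_qm_agree:
  assumes "a \<in> subalg B_qm"
  shows "(vfield px ^^ n) ((vfield pz ^^ n') a) = (Dx ^^ n) ((Dz ^^ n') a)"
proof -
  have z: "(vfield pz ^^ n) a = (Dz ^^ n) a \<and> (Dz ^^ n) a \<in> subalg B_qm"
    if "a \<in> subalg B_qm" for n a
    unfolding Dz_def using that
    by (intro vfield_pow_agree)
      (auto simp: vfield_gen_inverse elim!: B_qm.cases intro!: subalg_0 subalg_1 B_qm.intros[THEN subalg_base])
  have x: "(vfield px ^^ n) a = (Dx ^^ n) a" if "a \<in> subalg B_qm" for n a
    unfolding Dx_def using that
    by (intro conjunct1[OF vfield_pow_agree])
      (auto simp: vfield_gen_inverse elim!: B_qm.cases intro!: subalg_0 subalg_1 B_qm.intros[THEN subalg_base])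
  show ?thesis using z[OF assms] x by simp
qed

lemma qm_subalg:
  "u_x * q_el \<alpha> 1 0 + prev (\<lambda>\<gamma>. q_el \<gamma> 1 0) \<alpha> \<in> subalg B_qm"
  "u_x * m_el \<alpha> 1 0 - z_el / t_el * m_el \<alpha> 1 0 - 1 / t_el * prev (\<lambda>\<gamma>. m_el \<gamma> 1 0) \<alpha> \<in> subalg B_qm"
  "u_z * q_el \<alpha> 1 0 + prev (\<lambda>\<gamma>. q_el \<gamma> 0 1) \<alpha> \<in> subalg B_qm"
  "u_z * m_el \<alpha> 1 0 - z_el / t_el * m_el \<alpha> 0 1 - 1 / t_el * prev (\<lambda>\<gamma>. m_el \<gamma> 0 1) \<alpha> \<in> subalg B_qm"
proof -
  have q: "prev (\<lambda>\<gamma>. q_el \<gamma> a b) \<alpha> \<in> subalg B_qm" for a b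
    by (cases \<alpha>) (auto intro: subalg_0 subalg_base B_qm.intros)
  have m: "prev (\<lambda>\<gamma>. m_el \<gamma> a b) \<alpha> \<in> subalg B_qm" for a b
    by (cases \<alpha>) (auto intro: subalg_0 subalg_base B_qm.intros)
  have uz: "u_z \<in> subalg B_qm"
    by (auto intro: subalg_base B_qm.intros)
  have g: "b \<in> B_qm \<Longrightarrow> b \<in> subalg B_qm" for b
    by (rule subalg_base)
  note rules = subalg_diff subalg_add subalg_mult subalg_1 q m uz B_qm.intros[THEN g]
  show "u_x * q_el \<alpha> 1 0 + prev (\<lambda>\<gamma>. q_el \<gamma> 1 0) \<alpha> \<in> subalg B_qm"
    by (intro rules)
  show "u_x * m_el \<alpha> 1 0 - z_el / t_el * m_el \<alpha> 1 0 - 1 / t_el * prev (\<lambda>\<gamma>. m_el \<gamma> 1 0) \<alpha> \<in> subalg B_qm"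
    unfolding divide_alg_def by (intro rules)
  show "u_z * q_el \<alpha> 1 0 + prev (\<lambda>\<gamma>. q_el \<gamma> 0 1) \<alpha> \<in> subalg B_qm"
    by (intro rules)
  show "u_z * m_el \<alpha> 1 0 - z_el / t_el * m_el \<alpha> 0 1 - 1 / t_el * prev (\<lambda>\<gamma>. m_el \<gamma> 0 1) \<alpha> \<in> subalg B_qm"
    unfolding divide_alg_def by (intro rules)
qed

lemma Dx_r_el: "Dx_r \<beta> = Dx (r_el \<beta>)"
  by (cases \<beta>) (simp_all add: Dx_def vfield_uminus)

lemma total_derivatives_xyzt:
  "Dx (gen cX) = 1" "Dx (gen cY) = 0" "Dx (gen cZ) = 0" "Dx (gen cT) = 0"
  "Dy (gen cX) = 0" "Dy (gen cY) = 1" "Dy (gen cZ) = 0" "Dy (gen cT) = 0"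
  "Dz (gen cX) = 0" "Dz (gen cY) = 0" "Dz (gen cZ) = 1" "Dz (gen cT) = 0"
  "Dt (gen cX) = 0" "Dt (gen cY) = 0" "Dt (gen cZ) = 0" "Dt (gen cT) = 1"
  by (simp_all add: Dx_def Dy_def Dz_def Dt_def)

lemma total_derivatives_u:
  "Dx (u_el i j) = u_el (i + 1) j" "Dt (u_el i j) = u_el i (j + 1)"
  "Dx (uy_el i k j) = uy_el (i + 1) k j" "Dt (uy_el i k j) = uy_el i k (j + 1)"
  "Dx (uz_el i l j) = uz_el (i + 1) l j" "Dt (uz_el i l j) = uz_el i l (j + 1)"
  "Dy (uy_el i k j) = uy_el i (k + 1) j" "Dz (uz_el i l j) = uz_el i (l + 1) j"
  "Dy (uz_el i (l + 1) j) = (Dx ^^ i) ((Dz ^^ l) ((Dt ^^ j) G_el))"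
  "Dz (uy_el i (k + 1) j) = (Dx ^^ i) ((Dy ^^ k) ((Dt ^^ j) G_el))"
  using Dy_uz[of i l j] Dz_uy[of i k j]
  by (cases k; cases l; simp add: Dx_def Dy_def Dz_def Dt_def)+

lemma total_derivatives_q:
  "Dx (q_el \<alpha> a b) = q_el \<alpha> (a + 1) b" "Dz (q_el \<alpha> a b) = q_el \<alpha> a (b + 1)"
  "Dy (q_el \<alpha> a b) = (Dx ^^ a) ((Dz ^^ b)
     (u_x * q_el \<alpha> 1 0 + prev (\<lambda>\<gamma>. q_el \<gamma> 1 0) \<alpha>))"
  "Dt (q_el \<alpha> a b) = (Dx ^^ a) ((Dz ^^ b)
     (u_z * q_el \<alpha> 1 0 + prev (\<lambda>\<gamma>. q_el \<gamma> 0 1) \<alpha>))"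
  unfolding qm_subalg[THEN pow_qm_agree, symmetric] by (simp_all add: Dx_def Dy_def Dz_def Dt_def)

lemma total_derivatives_m:
  "Dx (m_el \<alpha> a b) = m_el \<alpha> (a + 1) b" "Dz (m_el \<alpha> a b) = m_el \<alpha> a (b + 1)"
  "Dy (m_el \<alpha> a b) = (Dx ^^ a) ((Dz ^^ b)
     (u_x * m_el \<alpha> 1 0 - z_el / t_el * m_el \<alpha> 1 0 - 1 / t_el * prev (\<lambda>\<gamma>. m_el \<gamma> 1 0) \<alpha>))"
  "Dt (m_el \<alpha> a b) = (Dx ^^ a) ((Dz ^^ b)
     (u_z * m_el \<alpha> 1 0 - z_el / t_el * m_el \<alpha> 0 1 - 1 / t_el * prev (\<lambda>\<gamma>. m_el \<gamma> 0 1) \<alpha>))"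
  unfolding qm_subalg[THEN pow_qm_agree, symmetric] by (simp_all add: Dx_def Dy_def Dz_def Dt_def)

lemma total_derivatives_r:
  "Dy (gen (cR \<beta> a b)) = gen (cR \<beta> (a + 1) b)" "Dt (gen (cR \<beta> a b)) = gen (cR \<beta> a (b + 1))"
  "Dx (gen (cR \<beta> a b)) = (Dy ^^ a) ((Dt ^^ b) (u_x * Dx (r_el \<beta>) - Dy (r_el \<beta>)))"
  "Dz (gen (cR \<beta> a b)) = (Dy ^^ a) ((Dt ^^ b) (u_z * Dx (r_el \<beta>) - Dt (r_el \<beta>)))"
  unfolding Dx_r_el[symmetric] by (simp_all add: Dx_def Dy_def Dz_def Dt_def)

text \<open>
  A sequence \<open>P\<close> lists its entries in the order \<open>p_0, p_0^q, p_0^m, p_1^r, p_1^q, p_1^m, \<dots>\<close>.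
  The case \<open>\<beta> = 0\<close> of \<open>comp_r\<close> is the convention \<open>p_0^r = - p_0\<close>.
\<close>

type_synonym seqA = "nat \<Rightarrow> alg"

definition comp_0 :: "seqA \<Rightarrow> alg" where "comp_0 P = P 0"
definition comp_q :: "seqA \<Rightarrow> nat \<Rightarrow> alg" where "comp_q P \<alpha> = P (3 * \<alpha> + 1)"
definition comp_m :: "seqA \<Rightarrow> nat \<Rightarrow> alg" where "comp_m P \<alpha> = P (3 * \<alpha> + 2)"
definition comp_r :: "seqA \<Rightarrow> nat \<Rightarrow> alg" where
  "comp_r P \<beta> = (if \<beta> = 0 then - P 0 else P (3 * \<beta>))"

definition mk_seq :: "alg \<Rightarrow> (nat \<Rightarrow> alg) \<Rightarrow> (nat \<Rightarrow> alg) \<Rightarrow> (nat \<Rightarrow> alg) \<Rightarrow> seqA" where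
  "mk_seq p0 pq pm pr n =
    (if n = 0 then p0
     else if n mod 3 = 0 then pr (n div 3)
     else if n mod 3 = 1 then pq (n div 3)
     else pm (n div 3))"

lemma comp_mk_seq:
  "comp_0 (mk_seq p0 pq pm pr) = p0"
  "comp_q (mk_seq p0 pq pm pr) \<alpha> = pq \<alpha>"
  "comp_m (mk_seq p0 pq pm pr) \<alpha> = pm \<alpha>"
  "\<beta> \<ge> 1 \<Longrightarrow> comp_r (mk_seq p0 pq pm pr) \<beta> = pr \<beta>"
proof -
  have "(3 * \<alpha> + 1) mod 3 = 1" "(3 * \<alpha> + 1) div 3 = \<alpha>" "(3 * \<alpha> + 2) mod 3 = 2" "(3 * \<alpha> + 2) div 3 = \<alpha>"
    by presburger+
  then show "comp_0 (mk_seq p0 pq pm pr) = p0"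
    "comp_q (mk_seq p0 pq pm pr) \<alpha> = pq \<alpha>"
    "comp_m (mk_seq p0 pq pm pr) \<alpha> = pm \<alpha>"
    "\<beta> \<ge> 1 \<Longrightarrow> comp_r (mk_seq p0 pq pm pr) \<beta> = pr \<beta>"
    by (simp_all add: comp_0_def comp_q_def comp_m_def comp_r_def mk_seq_def)
qed

abbreviation q_x :: "nat \<Rightarrow> alg" where "q_x \<alpha> \<equiv> Dx (q_el \<alpha> 0 0)"
abbreviation m_x :: "nat \<Rightarrow> alg" where "m_x \<alpha> \<equiv> Dx (m_el \<alpha> 0 0)"
abbreviation r_x :: "nat \<Rightarrow> alg" where "r_x \<beta> \<equiv> Dx (r_el \<beta>)"

definition sym_A :: "seqA set" where
  "sym_A = {P.
     Dy (Dz (comp_0 P)) - Dt (Dx (comp_0 P)) + u_z * Dx (Dx (comp_0 P)) - u_x * Dx (Dz (comp_0 P))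
       + u_xx * Dz (comp_0 P) - u_xz * Dx (comp_0 P) = 0 \<and>
     (\<forall>\<alpha>. Dt (comp_q P \<alpha>) - u_z * Dx (comp_q P \<alpha>) - q_x \<alpha> * Dz (comp_0 P)
       - Dz (prev (comp_q P) \<alpha>) = 0) \<and>
     (\<forall>\<alpha>. Dy (comp_q P \<alpha>) - u_x * Dx (comp_q P \<alpha>) - q_x \<alpha> * Dx (comp_0 P)
       - Dx (prev (comp_q P) \<alpha>) = 0) \<and>
     (\<forall>\<alpha>. Dt (comp_m P \<alpha>) - u_z * Dx (comp_m P \<alpha>) - m_x \<alpha> * Dz (comp_0 P)
       + z_el / t_el * Dz (comp_m P \<alpha>) + 1 / t_el * Dz (prev (comp_m P) \<alpha>) = 0) \<and>
     (\<forall>\<alpha>. Dy (comp_m P \<alpha>) - u_x * Dx (comp_m P \<alpha>) - m_x \<alpha> * Dx (comp_0 P)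
       + z_el / t_el * Dx (comp_m P \<alpha>) + 1 / t_el * Dx (prev (comp_m P) \<alpha>) = 0) \<and>
     Dx (comp_r P 1) - Dy (comp_0 P) + 2 * u_x * Dx (comp_0 P) = 0 \<and>
     Dz (comp_r P 1) - Dt (comp_0 P) + u_x * Dz (comp_0 P) + u_z * Dx (comp_0 P) = 0 \<and>
     (\<forall>\<beta>\<ge>2. Dx (comp_r P \<beta>) - u_x * Dx (comp_r P (\<beta> - 1)) - r_x (\<beta> - 1) * Dx (comp_0 P)
       + Dy (comp_r P (\<beta> - 1)) = 0) \<and>
     (\<forall>\<beta>\<ge>2. Dz (comp_r P \<beta>) - u_z * Dx (comp_r P (\<beta> - 1)) - r_x (\<beta> - 1) * Dz (comp_0 P)
       + Dt (comp_r P (\<beta> - 1)) = 0)}"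

definition Rq :: "seqA \<Rightarrow> seqA" where
  "Rq P = mk_seq
     (u_x * comp_0 P + comp_r P 1)
     (\<lambda>\<alpha>. q_x \<alpha> * comp_0 P + prev (comp_q P) \<alpha>)
     (\<lambda>\<alpha>. m_x \<alpha> * comp_0 P - 1 / t_el * prev (comp_m P) \<alpha> - z_el / t_el * comp_m P \<alpha>)
     (\<lambda>\<beta>. r_x \<beta> * comp_0 P - comp_r P (\<beta> + 1))"

definition Rm :: "seqA \<Rightarrow> seqA" where
  "Rm P = (\<lambda>n. t_el * Rq P n + z_el * P n)"

instantiation "fun" :: (type, real_vector) real_vector
begin

definition scaleR_fun :: "real \<Rightarrow> ('a \<Rightarrow> 'b) \<Rightarrow> 'a \<Rightarrow> 'b" where
  "scaleR_fun a f = (\<lambda>x. a *\<^sub>R f x)"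

instance
  by standard (simp_all add: scaleR_fun_def fun_eq_iff scaleR_add_right scaleR_add_left)

end

definition automorphism_on :: "('v::real_vector) set \<Rightarrow> ('v \<Rightarrow> 'v) \<Rightarrow> bool" where
  "automorphism_on V f \<longleftrightarrow> subspace V \<and> bij_betw f V V \<and>
     (\<forall>x\<in>V. \<forall>y\<in>V. f (x + y) = f x + f y) \<and>
     (\<forall>a. \<forall>x\<in>V. f (a *\<^sub>R x) = a *\<^sub>R f x)"

end

theory Submission
  imports Defs
begin

text \<open>
  Solving \<open>Ph = Rq P\<close> (or \<open>Ph = Rm P\<close>) for the entries of \<open>P\<close> is triangular, because \<open>q_x 0\<close>,
  \<open>m_x 0\<close>, \<open>z\<close> and \<open>t\<close> are units: both maps are bijections of the space of all sequences, and
  solving the first-order linear recurrences gives the inverse formulas. Hence it is enough that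
  \<open>P\<close> is a symmetry iff its image is. The left-hand sides of (NS2)--(NS9) for \<open>Rq P\<close> and \<open>Rm P\<close>
  are linear combinations of those for \<open>P\<close>, by a system that is again triangular. These
  identities, and the redundancy of (NS1), use that the total derivatives commute. On coordinates
  this is a computation; it extends to the whole algebra because the commutator of two vector
  fields is a vector field, which rests on the symmetry of second partial derivatives.
\<close>

section \<open>Symmetry of second partial derivatives\<close>

text \<open>The mean value theorem is used twice: in the first variable for
  \<open>f s (b + h) - f s b\<close>, then in the second for \<open>fx s\<close>.\<close>

lemma second_difference_mean_value:
  fixes f :: "real \<Rightarrow> real \<Rightarrow> real"
  assumes fx: "\<And>s r. ((\<lambda>s. f s r) has_real_derivative fx s r) (at s)"
    and fxy: "\<And>s r. ((\<lambda>r. fx s r) has_real_derivative fxy s r) (at r)"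
    and "h > 0"
  shows "\<exists>s r. a < s \<and> s < a + h \<and> b < r \<and> r < b + h \<and>
    f (a + h) (b + h) - f (a + h) b - f a (b + h) + f a b = h * h * fxy s r"
proof -
  have "((\<lambda>s. f s (b + h) - f s b) has_real_derivative fx s (b + h) - fx s b) (at s)" for s
    by (intro DERIV_diff fx)
  then obtain s where s: "a < s" "s < a + h"
    "f (a + h) (b + h) - f (a + h) b - (f a (b + h) - f a b) = (a + h - a) * (fx s (b + h) - fx s b)"
    using MVT2[of a "a + h" "\<lambda>s. f s (b + h) - f s b" "\<lambda>s. fx s (b + h) - fx s b"] \<open>h > 0\<close>
    by auto
  obtain r where "b < r" "r < b + h" "fx s (b + h) - fx s b = (b + h - b) * fxy s r"
    using MVT2[of b "b + h" "fx s" "fxy s"] fxy \<open>h > 0\<close> by auto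
  with s show ?thesis by (intro exI[of _ s] exI[of _ r]) (auto simp: algebra_simps)
qed

text \<open>The second difference over a square of side h equals h^2 times either mixed derivative
  at some point of the square. Dividing by h^2 and shrinking the square to the corner, continuity
  gives equality there.\<close>

lemma mixed_derivatives_eq:
  fixes f :: "real \<Rightarrow> real \<Rightarrow> real"
  assumes fx: "\<And>s r. ((\<lambda>s. f s r) has_real_derivative fx s r) (at s)"
    and fxy: "\<And>s r. ((\<lambda>r. fx s r) has_real_derivative fxy s r) (at r)"
    and fy: "\<And>s r. ((\<lambda>r. f s r) has_real_derivative fy s r) (at r)"
    and fyx: "\<And>s r. ((\<lambda>s. fy s r) has_real_derivative fyx s r) (at s)"
    and cont: "continuous_on UNIV (\<lambda>(s, r). fxy s r)" "continuous_on UNIV (\<lambda>(s, r). fyx s r)"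
  shows "fxy a b = fyx a b"
proof -
  define h :: "nat \<Rightarrow> real" where "h n = inverse (real (Suc n))" for n
  have h: "h n > 0" for n by (simp add: h_def)
  have h0: "h \<longlonglongrightarrow> 0" unfolding h_def by (rule LIMSEQ_inverse_real_of_nat)
  \<comment> \<open>The intermediate points are uncontrolled, but they lie in squares shrinking to
    \<open>(a, b)\<close>.\<close>
  have lim: "(\<lambda>n. g (s n) (r n)) \<longlonglongrightarrow> g a b"
    if "continuous_on UNIV (\<lambda>(s, r). g s r)" and sr: "\<And>n. a < s n \<and> s n < a + h n \<and> b < r n \<and> r n < b + h n"
    for g :: "real \<Rightarrow> real \<Rightarrow> real" and s r
  proof -
    have between: "x \<longlonglongrightarrow> c" if x: "\<And>n. c < x n \<and> x n < c + h n" for x and c :: real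
    proof (rule tendsto_sandwich[where f = "\<lambda>_. c" and h = "\<lambda>n. c + h n"])
      show "(\<lambda>n. c + h n) \<longlonglongrightarrow> c" using tendsto_add[OF tendsto_const h0, of c] by simp
    qed (use x in \<open>auto intro!: always_eventually simp: less_imp_le\<close>)
    have "s \<longlonglongrightarrow> a" "r \<longlonglongrightarrow> b" using sr by (blast intro: between)+
    then have "(\<lambda>n. (s n, r n)) \<longlonglongrightarrow> (a, b)" by (rule tendsto_Pair)
    moreover have "isCont (\<lambda>(s, r). g s r) (a, b)"
      using that(1) by (simp add: continuous_on_eq_continuous_at)
    ultimately show ?thesis using isCont_tendsto_compose by fastforce
  qed
  have "\<exists>s r. a < s \<and> s < a + h n \<and> b < r \<and> r < b + h n \<and>
      f (a + h n) (b + h n) - f (a + h n) b - f a (b + h n) + f a b = h n * h n * fxy s r" for n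
    by (rule second_difference_mean_value[OF fx fxy h])
  then obtain s r where sr: "\<And>n. a < s n \<and> s n < a + h n \<and> b < r n \<and> r n < b + h n"
    and 1: "\<And>n. f (a + h n) (b + h n) - f (a + h n) b - f a (b + h n) + f a b = h n * h n * fxy (s n) (r n)"
    by metis
  \<comment> \<open>The same lemma for the transposed function; only the two middle terms of the
    difference change places.\<close>
  have "\<exists>r s. b < r \<and> r < b + h n \<and> a < s \<and> s < a + h n \<and>
      f (a + h n) (b + h n) - f a (b + h n) - f (a + h n) b + f a b = h n * h n * fyx s r" for n
    by (rule second_difference_mean_value[of "\<lambda>r s. f s r" "\<lambda>r s. fy s r" "\<lambda>r s. fyx s r", OF fy fyx h])
  then obtain s' r' where sr': "\<And>n. a < s' n \<and> s' n < a + h n \<and> b < r' n \<and> r' n < b + h n"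
    and 2: "\<And>n. f (a + h n) (b + h n) - f a (b + h n) - f (a + h n) b + f a b = h n * h n * fyx (s' n) (r' n)"
    by metis
  have "fxy (s n) (r n) = fyx (s' n) (r' n)" for n
  proof -
    have "h n * h n * fxy (s n) (r n) = h n * h n * fyx (s' n) (r' n)"
      using 1[of n] 2[of n] by linarith
    then show ?thesis using h[of n] by simp
  qed
  then have "(\<lambda>n. fyx (s' n) (r' n)) \<longlonglongrightarrow> fxy a b"
    using lim[OF cont(1) sr] by simp
  then show ?thesis using lim[OF cont(2) sr'] LIMSEQ_unique by blast
qed

text \<open>\<open>smooth_fun\<close> asks for differentiability at the value \<open>p c\<close>
  only; applied to \<open>p(c := s)\<close> it gives every point of the coordinate line.\<close>

lemma smooth_fun_differentiable:
  assumes "smooth_fun f"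
  shows "((\<lambda>s. f (p(c := s))) has_real_derivative pd c f (p(c := s))) (at s)"
proof -
  have "(\<lambda>s'. f ((p(c := s))(c := s'))) differentiable (at ((p(c := s)) c))"
    using assms unfolding smooth_fun_def by (metis foldr_Nil id_apply)
  then show ?thesis by (simp add: pd_def DERIV_deriv_iff_real_differentiable)
qed

lemma smooth_fun_continuous: "smooth_fun f \<Longrightarrow> continuous_on UNIV f"
  unfolding smooth_fun_def by (metis foldr_Nil id_apply)

lemma pd_commute:
  assumes f: "smooth_fun f"
  shows "pd c (pd c' f) = pd c' (pd c f)"
proof (cases "c = c'")
  case False
  show ?thesis
  proof
    fix p :: point
    define P where "P s r = p(c := s, c' := r)" for s r
    \<comment> \<open>Either update can be made the outer one, which turns a partial derivative into
      a derivative in one real variable.\<close>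
    have P: "P s r = (p(c' := r))(c := s)" "P s r = (p(c := s))(c' := r)" for s r
      using False by (auto simp: P_def fun_upd_twist)
    have "continuous_on UNIV (\<lambda>(s, r). P s r)"
    proof (rule continuous_on_coordinatewise_then_product)
      fix i
      show "continuous_on UNIV (\<lambda>x. (case x of (s, r) \<Rightarrow> P s r) i)"
        by (cases "i = c'"; cases "i = c")
          (simp_all add: P_def case_prod_beta continuous_on_fst continuous_on_snd)
    qed
    then have cont: "continuous_on UNIV (\<lambda>(s, r). g (P s r))" if "smooth_fun g" for g
      using continuous_on_compose2[OF smooth_fun_continuous[OF that], of UNIV "\<lambda>(s, r). P s r"]
      by (simp add: case_prod_beta)
    have "pd c' (pd c f) (P (p c) (p c')) = pd c (pd c' f) (P (p c) (p c'))"
    proof (rule mixed_derivatives_eq[where a = "p c" and b = "p c'"])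
      fix s r
      show "((\<lambda>s. f (P s r)) has_real_derivative pd c f (P s r)) (at s)"
        "((\<lambda>s. pd c' f (P s r)) has_real_derivative pd c (pd c' f) (P s r)) (at s)"
        unfolding P(1) by (intro smooth_fun_differentiable smooth_pd f)+
      show "((\<lambda>r. f (P s r)) has_real_derivative pd c' f (P s r)) (at r)"
        "((\<lambda>r. pd c f (P s r)) has_real_derivative pd c' (pd c f) (P s r)) (at r)"
        unfolding P(2) by (intro smooth_fun_differentiable smooth_pd f)+
    qed (intro cont smooth_pd f)+
    then show "pd c (pd c' f) p = pd c' (pd c f) p" by (simp add: P_def)
  qed
qed simp

section \<open>Induction over the algebra and commuting partial derivatives on it\<close>

lemma pdiff_const: "pdiff c (a *\<^sub>R 1) = 0"
proof transfer
  fix c and a :: real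
  have "pd c (\<lambda>p. a * 1) = (\<lambda>p. 0)" by (simp add: pd_def fun_eq_iff)
  then show "alg_rel (pd c (\<lambda>p. a * 1)) (\<lambda>p. 0)"
    by (simp add: alg_rel_def representative_gen gen_const)
qed

lemma pdiff_scaleR: "pdiff c (a *\<^sub>R b) = a *\<^sub>R pdiff c b"
  using pdiff_mult[of c "a *\<^sub>R 1" b] by (simp add: pdiff_const)

lemma pdiff_uminus: "pdiff c (- a) = - pdiff c a"
  using pdiff_add[of c a "- a"] by (simp add: eq_neg_iff_add_eq_0 add.commute)

text \<open>Differentiate \<open>gen c' * gen_inv c' = 1\<close> and multiply by
  \<open>gen_inv c'\<close>.\<close>

lemma pdiff_gen_inv: "pdiff c (gen_inv c') = (if c = c' then - (gen_inv c' * gen_inv c') else 0)"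
proof -
  have "pdiff c (gen c' * gen_inv c') = 0" by (simp add: gen_gen_inv)
  then have "gen c' * pdiff c (gen_inv c') = - (pdiff c (gen c') * gen_inv c')"
    by (simp only: pdiff_mult) (simp add: eq_neg_iff_add_eq_0 add.commute)
  then have "gen_inv c' * gen c' * pdiff c (gen_inv c') = - (pdiff c (gen c') * (gen_inv c' * gen_inv c'))"
    by (simp only: mult.assoc) (simp add: ac_simps)
  then show ?thesis by (simp add: mult.commute[of "gen_inv c'" "gen c'"] gen_gen_inv pdiff_gen)
qed

text \<open>Laurent polynomials are built from constants, coordinates and inverted coordinates by
  finite sums and products, so besides smooth functions only these need be treated.\<close>

lemma alg_induct:
  assumes smooth: "\<And>f. f \<in> smooth_algebra \<Longrightarrow> Q (abs_alg f)"
    and gen: "\<And>c. Q (gen c)" "\<And>c. Q (gen_inv c)"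
    and const: "\<And>r. Q (r *\<^sub>R 1)"
    and add: "\<And>a b. Q a \<Longrightarrow> Q b \<Longrightarrow> Q (a + b)"
    and mult: "\<And>a b. Q a \<Longrightarrow> Q b \<Longrightarrow> Q (a * b)"
  shows "Q a"
proof -
  have rel: "alg_rel f f" if "f \<in> gen_algebra" for f
    using that by (simp add: alg_rel_def representative_gen)
  define K where "K = {f \<in> gen_algebra. Q (abs_alg f)}"
  have K_add: "(\<lambda>p. f p + g p) \<in> K" if "f \<in> K" "g \<in> K" for f g
    using that add[of "abs_alg f" "abs_alg g"] gen_algebra.add[of f g]
    by (simp add: K_def rel plus_alg.abs_eq)
  have K_mult: "(\<lambda>p. f p * g p) \<in> K" if "f \<in> K" "g \<in> K" for f g
    using that mult[of "abs_alg f" "abs_alg g"] gen_algebra.mult[of f g]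
    by (simp add: K_def rel times_alg.abs_eq)
  have K_const: "(\<lambda>p. r) \<in> K" for r
    using const[of r] rel[OF gen_const[of 1]]
    by (simp add: K_def gen_const one_alg_def scaleR_alg.abs_eq)
  have K_sum: "(\<lambda>p. \<Sum>i\<in>I. f i p) \<in> K" if "\<And>i. i \<in> I \<Longrightarrow> f i \<in> K" for I :: "nat set" and f
    using that by (induction I rule: infinite_finite_induct) (auto intro: K_const K_add)
  have K_prod: "(\<lambda>p. \<Prod>i\<in>I. f i p) \<in> K" if "\<And>i. i \<in> I \<Longrightarrow> f i \<in> K" for I :: "coord set" and f
    using that by (induction I rule: infinite_finite_induct) (auto intro: K_const K_mult)
  have K_power: "(\<lambda>p. f p ^ n) \<in> K" if "f \<in> K" for f n
    using that by (induction n) (auto intro: K_const K_mult)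
  have "(\<lambda>p. p c) \<in> K" "(\<lambda>p. inverse (p c)) \<in> K" for c
    using gen[of c] by (simp_all add: K_def gen_def gen_inv_def gen_coord gen_inverse_coord)
  then have K_powi: "(\<lambda>p. p c powi e) \<in> K" for c e
    by (cases "e \<ge> 0") (auto simp: power_int_def intro: K_power)
  have "g \<in> K" if "g \<in> gen_algebra" for g
    using that
  proof induction
    case (base f)
    then show ?case
    proof
      assume "f \<in> smooth_algebra"
      then show ?thesis by (simp add: K_def smooth gen_algebra.base)
    next
      assume "f \<in> laurent_algebra"
      then obtain I :: "nat set" and S a e
        where "f = (\<lambda>p. \<Sum>i\<in>I. a i * (\<Prod>c\<in>S. p c powi e i c))"
        unfolding laurent_algebra_def by blast
      then show ?thesis by (auto intro!: K_sum K_mult K_const K_prod K_powi)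
    qed
  qed (auto intro: K_add K_mult)
  \<comment> \<open>\<open>rep_alg a\<close> need not lie in \<open>gen_algebra\<close>; it only
    agrees with such a function where finitely many coordinates are nonzero, and this is the same
    class.\<close>
  moreover obtain g where "g \<in> gen_algebra" "a = abs_alg g"
  proof -
    have f: "alg_rel (rep_alg a) (rep_alg a)" by (rule Quotient3_rep_reflp[OF Quotient3_alg])
    then obtain g where g: "g \<in> gen_algebra" "agree (rep_alg a) g"
      unfolding alg_rel_def representative_def by blast
    then have "alg_rel (rep_alg a) g"
      using f by (simp add: alg_rel_def representative_gen)
    then have "abs_alg (rep_alg a) = abs_alg g" by (rule Quotient3_rel_abs[OF Quotient3_alg])
    then show ?thesis using that g by (simp add: Quotient3_abs_rep[OF Quotient3_alg])
  qed
  ultimately show ?thesis by (simp add: K_def)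
qed

lemma pdiff_commute: "pdiff c (pdiff c' a) = pdiff c' (pdiff c a)"
proof (induction a rule: alg_induct)
  case (1 f)
  have rel: "g \<in> smooth_algebra \<Longrightarrow> alg_rel g g" for g
    by (simp add: alg_rel_def representative_gen gen_algebra.base)
  show ?case
    using pd_commute[of f c c'] 1 smooth_algebra_pd[of f]
    by (simp add: pdiff.abs_eq rel) (simp add: smooth_algebra_def)
next
  case (5 a b)
  then show ?case by (simp add: pdiff_add)
next
  case (6 a b)
  then show ?case by (simp add: pdiff_mult pdiff_add algebra_simps)
qed (simp_all add: pdiff_gen pdiff_gen_inv pdiff_uminus pdiff_mult pdiff_const)

section \<open>Commuting total derivatives\<close>

lemma vfield_sum: "vfield v (sum f S) = (\<Sum>c\<in>S. vfield v (f c))"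
  by (induction S rule: infinite_finite_induct) (simp_all add: vfield_add)

text \<open>The second-order terms cancel because partial derivatives commute.\<close>

lemma vfield_commutator:
  "vfield v (vfield w a) - vfield w (vfield v a) = vfield (\<lambda>c. vfield v (w c) - vfield w (v c)) a"
proof -
  define S where "S = {c. pdiff c a \<noteq> 0}"
  have fin: "finite S" by (simp add: S_def pdiff_finite)
  \<comment> \<open>By commuting the derivatives, the finite index set of \<open>a\<close> also
    serves all its first derivatives.\<close>
  have S: "pdiff d (pdiff c a) = 0" if "d \<notin> S" for c d
    using that pdiff_commute[of d c a] by (simp add: S_def)
  have 1: "vfield v a = (\<Sum>c\<in>S. v c * pdiff c a)" for v
    by (simp add: S_def vfield_def)
  have 2: "vfield v (pdiff c a) = (\<Sum>d\<in>S. v d * pdiff d (pdiff c a))" for v c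
    by (rule vfield_superset[OF fin]) (use S in auto)
  have "vfield v (vfield w a) =
      (\<Sum>c\<in>S. vfield v (w c) * pdiff c a) + (\<Sum>c\<in>S. \<Sum>d\<in>S. w c * v d * pdiff d (pdiff c a))" for v w
    unfolding 1[of w]
    by (simp add: vfield_sum vfield_mult 2 sum_distrib_left mult.assoc flip: sum.distrib)
  moreover have "(\<Sum>c\<in>S. \<Sum>d\<in>S. w c * v d * pdiff d (pdiff c a)) =
      (\<Sum>c\<in>S. \<Sum>d\<in>S. v c * w d * pdiff d (pdiff c a))"
    by (subst sum.swap) (simp add: mult.commute[of "w _"] pdiff_commute)
  ultimately show ?thesis
    unfolding 1[of "\<lambda>c. vfield v (w c) - vfield w (v c)"] by (simp add: left_diff_distrib sum_subtractf)
qed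

text \<open>Relative to a set, since commutation is first obtained on subalgebras generated by some
  coordinates and only later on the whole algebra.\<close>

definition commute_on :: "alg set \<Rightarrow> (alg \<Rightarrow> alg) \<Rightarrow> (alg \<Rightarrow> alg) \<Rightarrow> bool" where
  "commute_on A f g \<longleftrightarrow> (\<forall>a\<in>A. f (g a) = g (f a))"

lemma commute_on_commute: "commute_on A f g \<longleftrightarrow> commute_on A g f"
  by (auto simp: commute_on_def)

lemma commute_on_funpow:
  assumes "commute_on A f g" "\<And>a. a \<in> A \<Longrightarrow> g a \<in> A" "a \<in> A"
  shows "f ((g ^^ n) a) = (g ^^ n) (f a)"
proof -
  have "(g ^^ n) a \<in> A \<and> f ((g ^^ n) a) = (g ^^ n) (f a)"
    using assms by (induction n) (auto simp: commute_on_def)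
  then show ?thesis ..
qed

lemma commute_on_vfield_subalg:
  assumes "\<And>b. b \<in> B \<Longrightarrow> vfield v (vfield w b) = vfield w (vfield v b)"
  shows "commute_on (subalg B) (vfield v) (vfield w)"
proof -
  have "vfield v (vfield w a) = vfield w (vfield v a)" if "a \<in> subalg B" for a
    using that
    by induction (simp_all add: assms vfield_add vfield_mult vfield_uminus algebra_simps)
  then show ?thesis by (simp add: commute_on_def)
qed

lemma commute_on_vfield_UNIV:
  assumes "\<And>c. vfield v (vfield w (gen c)) = vfield w (vfield v (gen c))"
  shows "commute_on UNIV (vfield v) (vfield w)"
proof -
  have "vfield (\<lambda>c. 0) a = 0" for a by (simp add: vfield_def)
  then show ?thesis using vfield_commutator[of v w] assms by (simp add: commute_on_def)
qed

section \<open>Calculus rules for the total derivatives\<close>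

lemma D_const [simp]:
  "Dx 0 = 0" "Dy 0 = 0" "Dz 0 = 0" "Dt 0 = 0" "Dx 1 = 0" "Dy 1 = 0" "Dz 1 = 0" "Dt 1 = 0"
  by (simp_all add: Dx_def Dy_def Dz_def Dt_def)

lemma D_linear [simp]:
  "Dx (a + b) = Dx a + Dx b" "Dy (a + b) = Dy a + Dy b"
  "Dz (a + b) = Dz a + Dz b" "Dt (a + b) = Dt a + Dt b"
  "Dx (a - b) = Dx a - Dx b" "Dy (a - b) = Dy a - Dy b"
  "Dz (a - b) = Dz a - Dz b" "Dt (a - b) = Dt a - Dt b"
  "Dx (- a) = - Dx a" "Dy (- a) = - Dy a" "Dz (- a) = - Dz a" "Dt (- a) = - Dt a"
  by (simp_all add: Dx_def Dy_def Dz_def Dt_def vfield_add vfield_diff vfield_uminus)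

lemma D_mult [simp]:
  "Dx (a * b) = Dx a * b + a * Dx b" "Dy (a * b) = Dy a * b + a * Dy b"
  "Dz (a * b) = Dz a * b + a * Dz b" "Dt (a * b) = Dt a * b + a * Dt b"
  by (simp_all add: Dx_def Dy_def Dz_def Dt_def vfield_mult)

lemma D_inverse [simp]:
  "Dx (inverse t_el) = 0" "Dy (inverse t_el) = 0" "Dz (inverse t_el) = 0"
  "Dt (inverse t_el) = - (inverse t_el * inverse t_el)"
  by (simp_all add: Dx_def Dy_def Dz_def Dt_def vfield_gen_inverse)

declare total_derivatives_xyzt [simp]

lemma D_u [simp]:
  "Dx (gen (cU i j)) = gen (cU (Suc i) j)" "Dt (gen (cU i j)) = gen (cU i (Suc j))"
  "Dy (gen (cU i j)) = gen (cUY i 0 j)" "Dz (gen (cU i j)) = gen (cUZ i 0 j)"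
  "Dx (gen (cUY i k j)) = gen (cUY (Suc i) k j)" "Dt (gen (cUY i k j)) = gen (cUY i k (Suc j))"
  "Dy (gen (cUY i k j)) = gen (cUY i (Suc k) j)"
  "Dx (gen (cUZ i l j)) = gen (cUZ (Suc i) l j)" "Dt (gen (cUZ i l j)) = gen (cUZ i l (Suc j))"
  "Dz (gen (cUZ i l j)) = gen (cUZ i (Suc l) j)"
  "Dy (gen (cUZ i l j)) = (Dx ^^ i) ((Dz ^^ l) ((Dt ^^ j) G_el))"
  "Dz (gen (cUY i k j)) = (Dx ^^ i) ((Dy ^^ k) ((Dt ^^ j) G_el))"
  using total_derivatives_u(9)[of i l j] total_derivatives_u(10)[of i k j]
  by (simp_all add: Dx_def Dy_def Dz_def Dt_def)

lemma D_q [simp]: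
  "Dx (q_el \<alpha> a b) = q_el \<alpha> (Suc a) b" "Dz (q_el \<alpha> a b) = q_el \<alpha> a (Suc b)"
  by (simp_all add: total_derivatives_q)

lemma D_m [simp]:
  "Dx (m_el \<alpha> a b) = m_el \<alpha> (Suc a) b" "Dz (m_el \<alpha> a b) = m_el \<alpha> a (Suc b)"
  by (simp_all add: total_derivatives_m)

lemma D_r [simp]:
  "Dy (gen (cR \<beta> a b)) = gen (cR \<beta> (Suc a) b)" "Dt (gen (cR \<beta> a b)) = gen (cR \<beta> a (Suc b))"
  by (simp_all add: total_derivatives_r)

section \<open>Commutators on the u-coordinates\<close>

lemma D_closedI:
  assumes "D = vfield v" "\<And>b. b \<in> B \<Longrightarrow> D b \<in> subalg B" "a \<in> subalg B"
  shows "D a \<in> subalg B"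
  using vfield_closed[of a B v] assms by simp

lemma D_funpow_closed:
  assumes "\<And>a. a \<in> subalg B \<Longrightarrow> D a \<in> subalg B" "a \<in> subalg B"
  shows "(D ^^ n) a \<in> subalg B"
  using assms by (induction n) auto

lemma D_xzt_closed:
  assumes "a \<in> subalg B_xzt"
  shows "Dx a \<in> subalg B_xzt" "Dz a \<in> subalg B_xzt" "Dt a \<in> subalg B_xzt"
  by (rule D_closedI[OF Dx_def _ assms] D_closedI[OF Dz_def _ assms] D_closedI[OF Dt_def _ assms];
    auto elim!: B_xzt.cases intro!: subalg_base B_xzt.intros)+

lemma G_el_xyzt: "G_el \<in> subalg B_xyzt"
  by (rule subalg_mono[OF G_el_subalg]) (rule B_xzt_B_xyzt)

text \<open>The order matters. \<open>Dx\<close> and \<open>Dt\<close> raise indices;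
  \<open>Dy\<close> of a z-coordinate is an iterated derivative of \<open>G_el\<close> inside
  \<open>B_xzt\<close>; \<open>Dz\<close> of a y-coordinate iterates \<open>Dy\<close>, whose
  closure is known by then.\<close>

lemma D_xyzt_closed:
  assumes "a \<in> subalg B_xyzt"
  shows "Dx a \<in> subalg B_xyzt" "Dt a \<in> subalg B_xyzt" "Dy a \<in> subalg B_xyzt" "Dz a \<in> subalg B_xyzt"
proof -
  have x: "Dx a \<in> subalg B_xyzt" if "a \<in> subalg B_xyzt" for a
    by (rule D_closedI[OF Dx_def _ that]) (auto elim!: B_xyzt.cases intro!: subalg_base B_xyzt.intros)
  have t: "Dt a \<in> subalg B_xyzt" if "a \<in> subalg B_xyzt" for a
    by (rule D_closedI[OF Dt_def _ that]) (auto elim!: B_xyzt.cases intro!: subalg_base B_xyzt.intros)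
  have "(Dx ^^ i) ((Dz ^^ l) ((Dt ^^ j) G_el)) \<in> subalg B_xzt" for i l j
    by (intro D_funpow_closed D_xzt_closed G_el_subalg)
  then have "(Dx ^^ i) ((Dz ^^ l) ((Dt ^^ j) G_el)) \<in> subalg B_xyzt" for i l j
    by (rule subalg_mono) (rule B_xzt_B_xyzt)
  then have y: "Dy a \<in> subalg B_xyzt" if "a \<in> subalg B_xyzt" for a
    by (intro D_closedI[OF Dy_def _ that]) (auto elim!: B_xyzt.cases intro: B_xyzt.intros[THEN subalg_base])
  have "(Dx ^^ i) ((Dy ^^ l) ((Dt ^^ j) G_el)) \<in> subalg B_xyzt" for i l j
    by (intro D_funpow_closed x y t G_el_xyzt)
  then have z: "Dz a \<in> subalg B_xyzt" if "a \<in> subalg B_xyzt" for a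
    by (intro D_closedI[OF Dz_def _ that]) (auto elim!: B_xyzt.cases intro: B_xyzt.intros[THEN subalg_base])
  show "Dx a \<in> subalg B_xyzt" "Dt a \<in> subalg B_xyzt" "Dy a \<in> subalg B_xyzt" "Dz a \<in> subalg B_xyzt"
    using assms by (rule x t y z)+
qed

lemmas commute_on_D_subalg =
  commute_on_vfield_subalg[of _ vx vy, folded Dx_def Dy_def]
  commute_on_vfield_subalg[of _ vx vz, folded Dx_def Dz_def]
  commute_on_vfield_subalg[of _ vx vt, folded Dx_def Dt_def]
  commute_on_vfield_subalg[of _ vt vy, folded Dt_def Dy_def]
  commute_on_vfield_subalg[of _ vt vz, folded Dt_def Dz_def]
  commute_on_vfield_subalg[of _ vy vz, folded Dy_def Dz_def]

text \<open>
  A total derivative of a coordinate can be an iterated total derivative of \<open>G_el\<close>, so the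
  commutators are computed in an order in which those needed in the iteration are known already.
\<close>

lemma commute_on_xyzt:
  "commute_on (subalg B_xyzt) Dx Dy" "commute_on (subalg B_xyzt) Dx Dz" "commute_on (subalg B_xyzt) Dx Dt"
  "commute_on (subalg B_xyzt) Dt Dy" "commute_on (subalg B_xyzt) Dt Dz" "commute_on (subalg B_xyzt) Dy Dz"
proof -
  show xy: "commute_on (subalg B_xyzt) Dx Dy" and xz: "commute_on (subalg B_xyzt) Dx Dz"
    and xt: "commute_on (subalg B_xyzt) Dx Dt"
    by (rule commute_on_D_subalg; auto elim!: B_xyzt.cases)+
  note G = G_el_xyzt
  \<comment> \<open>On \<open>B_xzt\<close> both derivatives only raise indices. This lets
    \<open>Dt\<close> pass powers of \<open>Dz\<close> before their commutation is known on
    \<open>B_xyzt\<close>.\<close>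
  have tz': "commute_on (subalg B_xzt) Dt Dz"
    by (rule commute_on_D_subalg) (auto elim!: B_xzt.cases)
  have pow: "f ((g ^^ n) a) = (g ^^ n) (f a)"
    if "commute_on (subalg B_xyzt) f g \<or> commute_on (subalg B_xyzt) g f" "g \<in> {Dx, Dy, Dz, Dt}"
      "a \<in> subalg B_xyzt" for f g n a
    using that(1)
    by (intro commute_on_funpow[of "subalg B_xyzt"])
      (use that D_xyzt_closed in \<open>auto simp: commute_on_commute[of _ g]\<close>)
  have cl: "(D ^^ n) a \<in> subalg B_xyzt" if "D \<in> {Dx, Dy, Dz, Dt}" "a \<in> subalg B_xyzt" for D n a
    using that D_xyzt_closed by (intro D_funpow_closed) auto
  have "Dt ((Dx ^^ i) ((Dz ^^ l) ((Dt ^^ j) G_el))) = (Dx ^^ i) ((Dz ^^ l) ((Dt ^^ Suc j) G_el))" for i l j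
  proof -
    have "Dt ((Dz ^^ l) ((Dt ^^ j) G_el)) = (Dz ^^ l) ((Dt ^^ Suc j) G_el)"
      using commute_on_funpow[OF tz'] by (simp add: D_xzt_closed D_funpow_closed G_el_subalg)
    then show ?thesis by (simp add: pow xt cl G)
  qed
  then show ty: "commute_on (subalg B_xyzt) Dt Dy"
    by (intro commute_on_D_subalg) (auto elim!: B_xyzt.cases)
  have "Dt ((Dx ^^ i) ((Dy ^^ l) ((Dt ^^ j) G_el))) = (Dx ^^ i) ((Dy ^^ l) ((Dt ^^ Suc j) G_el))" for i l j
    by (simp add: pow xt ty cl G)
  then show tz: "commute_on (subalg B_xyzt) Dt Dz"
    by (intro commute_on_D_subalg) (auto elim!: B_xyzt.cases)
  \<comment> \<open>The outer derivative has to pass powers of \<open>Dx\<close> only and is then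
    absorbed into its own power.\<close>
  have "Dy ((Dx ^^ i) ((Dy ^^ l) ((Dt ^^ j) G_el))) = (Dx ^^ i) ((Dy ^^ Suc l) ((Dt ^^ j) G_el))"
    "Dz ((Dx ^^ i) ((Dz ^^ l) ((Dt ^^ j) G_el))) = (Dx ^^ i) ((Dz ^^ Suc l) ((Dt ^^ j) G_el))" for i l j
    by (simp_all add: pow xy xz cl G)
  then show "commute_on (subalg B_xyzt) Dy Dz"
    by (intro commute_on_D_subalg) (auto elim!: B_xyzt.cases)
qed

section \<open>Commutators on the q- and m-coordinates\<close>

abbreviation B_uqm :: "alg set" where "B_uqm \<equiv> B_xyzt \<union> B_qm"

lemma D_uqm_closed:
  assumes "a \<in> subalg B_uqm"
  shows "Dx a \<in> subalg B_uqm" "Dz a \<in> subalg B_uqm"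
proof -
  have u: "a \<in> subalg B_uqm" if "a \<in> subalg B_xyzt" for a
    using that by (rule subalg_mono) simp
  have q: "b \<in> subalg B_uqm" if "b \<in> B_qm" for b
    using that by (simp add: subalg_base)
  show "Dx a \<in> subalg B_uqm"
    by (rule D_closedI[OF Dx_def _ assms])
      (auto elim!: B_qm.cases intro: u D_xyzt_closed subalg_base subalg_0 subalg_1 B_qm.intros[THEN q])
  show "Dz a \<in> subalg B_uqm"
    by (rule D_closedI[OF Dz_def _ assms])
      (auto elim!: B_qm.cases intro: u D_xyzt_closed subalg_base subalg_0 subalg_1 B_qm.intros[THEN q])
qed

lemma commute_on_xyzt_base:
  assumes "b \<in> B_xyzt"
  shows "Dx (Dy b) = Dy (Dx b)" "Dx (Dz b) = Dz (Dx b)" "Dx (Dt b) = Dt (Dx b)"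
    "Dt (Dy b) = Dy (Dt b)" "Dt (Dz b) = Dz (Dt b)" "Dy (Dz b) = Dz (Dy b)"
  using commute_on_xyzt subalg_base[OF assms] by (auto simp: commute_on_def)

text \<open>\<open>Dx\<close> and \<open>Dz\<close> raise upper indices, while \<open>Dy\<close> and
  \<open>Dt\<close> apply \<open>Dx ^^ a\<close> and \<open>Dz ^^ b\<close> to an element
  independent of \<open>a\<close> and \<open>b\<close>. The pair \<open>Dt\<close>,
  \<open>Dy\<close> is left out: there the differential equation itself enters.\<close>

lemma commute_on_uqm:
  "commute_on (subalg B_uqm) Dx Dy" "commute_on (subalg B_uqm) Dx Dz" "commute_on (subalg B_uqm) Dx Dt"
  "commute_on (subalg B_uqm) Dt Dz" "commute_on (subalg B_uqm) Dy Dz"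
proof -
  have B: "b \<in> B_xyzt \<or> b = z_el \<or> b = inverse t_el \<or> (\<exists>\<alpha> a c. b = q_el \<alpha> a c) \<or> (\<exists>\<alpha> a c. b = m_el \<alpha> a c)"
    if "b \<in> B_uqm" for b
    using that by (blast elim!: B_qm.cases intro: B_xyzt.intros)
  have A: "a \<in> subalg B_uqm" if "a \<in> subalg B_qm" for a
    using that by (rule subalg_mono) simp
  show xz: "commute_on (subalg B_uqm) Dx Dz" and "commute_on (subalg B_uqm) Dx Dt"
    and "commute_on (subalg B_uqm) Dx Dy"
    by (rule commute_on_D_subalg, drule B,
        auto simp: commute_on_xyzt_base total_derivatives_q(3,4) total_derivatives_m(3,4))+
  have z: "Dz ((Dx ^^ a) ((Dz ^^ b) c)) = (Dx ^^ a) ((Dz ^^ Suc b) c)" if "c \<in> subalg B_qm" for a b c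
    using commute_on_funpow[OF iffD1[OF commute_on_commute xz], of "(Dz ^^ b) c" a] A[OF that]
    by (simp add: D_uqm_closed D_funpow_closed)
  show "commute_on (subalg B_uqm) Dt Dz" "commute_on (subalg B_uqm) Dy Dz"
    by (rule commute_on_D_subalg, drule B,
        auto simp: commute_on_xyzt_base total_derivatives_q(3,4) total_derivatives_m(3,4) z qm_subalg[simplified])+
qed

lemma funpow_commute_uqm:
  assumes "c \<in> subalg B_qm"
  shows "Dy ((Dx ^^ a) ((Dz ^^ b) c)) = (Dx ^^ a) ((Dz ^^ b) (Dy c))"
    "Dt ((Dx ^^ a) ((Dz ^^ b) c)) = (Dx ^^ a) ((Dz ^^ b) (Dt c))"
proof -
  have c: "c \<in> subalg B_uqm"
    using assms by (rule subalg_mono) simp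
  have "(Dz ^^ b) c \<in> subalg B_uqm" by (intro D_funpow_closed D_uqm_closed c)
  note * = commute_on_funpow[OF _ _ this, where n = a] commute_on_funpow[OF _ _ c, where n = b]
  show "Dy ((Dx ^^ a) ((Dz ^^ b) c)) = (Dx ^^ a) ((Dz ^^ b) (Dy c))"
    using commute_on_uqm(1,5) by (simp add: * D_uqm_closed commute_on_commute[of _ Dy Dx])
  show "Dt ((Dx ^^ a) ((Dz ^^ b) c)) = (Dx ^^ a) ((Dz ^^ b) (Dt c))"
    using commute_on_uqm(3,4) by (simp add: * D_uqm_closed commute_on_commute[of _ Dt Dx])
qed

lemma D_q_yt [simp]:
  "Dy (q_el \<alpha> 0 0) = u_x * q_el \<alpha> 1 0 + prev (\<lambda>\<gamma>. q_el \<gamma> 1 0) \<alpha>"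
  "Dt (q_el \<alpha> 0 0) = u_z * q_el \<alpha> 1 0 + prev (\<lambda>\<gamma>. q_el \<gamma> 0 1) \<alpha>"
  "Dy (q_el \<alpha> (Suc 0) 0) = Dx (Dy (q_el \<alpha> 0 0))" "Dt (q_el \<alpha> (Suc 0) 0) = Dx (Dt (q_el \<alpha> 0 0))"
  "Dy (q_el \<alpha> 0 (Suc 0)) = Dz (Dy (q_el \<alpha> 0 0))" "Dt (q_el \<alpha> 0 (Suc 0)) = Dz (Dt (q_el \<alpha> 0 0))"
  by (simp_all add: total_derivatives_q)

lemma D_m_yt [simp]:
  "Dy (m_el \<alpha> 0 0) = u_x * m_el \<alpha> 1 0 - z_el / t_el * m_el \<alpha> 1 0 - 1 / t_el * prev (\<lambda>\<gamma>. m_el \<gamma> 1 0) \<alpha>"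
  "Dt (m_el \<alpha> 0 0) = u_z * m_el \<alpha> 1 0 - z_el / t_el * m_el \<alpha> 0 1 - 1 / t_el * prev (\<lambda>\<gamma>. m_el \<gamma> 0 1) \<alpha>"
  "Dy (m_el \<alpha> (Suc 0) 0) = Dx (Dy (m_el \<alpha> 0 0))" "Dt (m_el \<alpha> (Suc 0) 0) = Dx (Dt (m_el \<alpha> 0 0))"
  "Dy (m_el \<alpha> 0 (Suc 0)) = Dz (Dy (m_el \<alpha> 0 0))" "Dt (m_el \<alpha> 0 (Suc 0)) = Dz (Dt (m_el \<alpha> 0 0))"
  by (simp_all add: total_derivatives_m)

lemma D_prev [simp]:
  "Dx (prev f \<alpha>) = prev (\<lambda>\<gamma>. Dx (f \<gamma>)) \<alpha>" "Dy (prev f \<alpha>) = prev (\<lambda>\<gamma>. Dy (f \<gamma>)) \<alpha>"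
  "Dz (prev f \<alpha>) = prev (\<lambda>\<gamma>. Dz (f \<gamma>)) \<alpha>" "Dt (prev f \<alpha>) = prev (\<lambda>\<gamma>. Dt (f \<gamma>)) \<alpha>"
  by (cases \<alpha>; simp)+

text \<open>Integrability of the q-covering: after expansion the two sides differ by
  \<open>(G_el - Dy u_z) * q_x \<alpha>\<close>, which is zero by the equation.\<close>

lemma q_compatible: "Dt (Dy (q_el \<alpha> 0 0)) = Dy (Dt (q_el \<alpha> 0 0))"
  by (cases \<alpha>) (simp_all add: G_el_def algebra_simps numeral_2_eq_2)

lemma m_compatible: "Dt (Dy (m_el \<alpha> 0 0)) = Dy (Dt (m_el \<alpha> 0 0))"
  by (cases \<alpha>) (simp_all add: G_el_def algebra_simps numeral_2_eq_2 divide_alg_def)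

section \<open>Commutators on the whole algebra\<close>

lemmas commute_on_D_UNIV =
  commute_on_vfield_UNIV[of vx vy, folded Dx_def Dy_def]
  commute_on_vfield_UNIV[of vx vz, folded Dx_def Dz_def]
  commute_on_vfield_UNIV[of vx vt, folded Dx_def Dt_def]
  commute_on_vfield_UNIV[of vt vy, folded Dt_def Dy_def]
  commute_on_vfield_UNIV[of vt vz, folded Dt_def Dz_def]
  commute_on_vfield_UNIV[of vy vz, folded Dy_def Dz_def]

lemma gen_uqm_cases:
  obtains "gen c \<in> subalg B_uqm" | "c \<in> {cX, cY, cT}" | \<beta> a b where "c = cR \<beta> a b"
proof (cases c)
  case (cR \<beta> a b)
  then show ?thesis using that by blast
qed (use that in \<open>auto intro!: subalg_base intro: B_xyzt.intros B_qm.intros\<close>)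

lemma commute_on_uqm_gen:
  assumes "gen c \<in> subalg B_uqm"
  shows "Dx (Dy (gen c)) = Dy (Dx (gen c))" "Dx (Dz (gen c)) = Dz (Dx (gen c))"
    "Dx (Dt (gen c)) = Dt (Dx (gen c))" "Dt (Dz (gen c)) = Dz (Dt (gen c))" "Dy (Dz (gen c)) = Dz (Dy (gen c))"
  using commute_on_uqm assms by (auto simp: commute_on_def)

text \<open>Powers of \<open>Dx\<close> and \<open>Dz\<close> can be pulled out, which reduces the
  q- and m-coordinates to upper index (0,0). On the r-coordinates both derivatives just raise an
  index.\<close>

lemma commute_ty: "commute_on UNIV Dt Dy"
proof (rule commute_on_D_UNIV)
  fix c
  show "Dt (Dy (gen c)) = Dy (Dt (gen c))"
  proof (cases c)
    case (cQ \<alpha> a b)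
    have A: "Dy (q_el \<alpha> 0 0) \<in> subalg B_qm" "Dt (q_el \<alpha> 0 0) \<in> subalg B_qm"
      using qm_subalg by simp_all
    have "Dy (q_el \<alpha> a b) = (Dx ^^ a) ((Dz ^^ b) (Dy (q_el \<alpha> 0 0)))"
      "Dt (q_el \<alpha> a b) = (Dx ^^ a) ((Dz ^^ b) (Dt (q_el \<alpha> 0 0)))"
      by (simp_all only: total_derivatives_q(3,4) funpow_0)
    then show ?thesis by (simp only: cQ funpow_commute_uqm[OF A(1)] funpow_commute_uqm[OF A(2)] q_compatible)
  next
    case (cM \<alpha> a b)
    have A: "Dy (m_el \<alpha> 0 0) \<in> subalg B_qm" "Dt (m_el \<alpha> 0 0) \<in> subalg B_qm"
      using qm_subalg by simp_all
    have "Dy (m_el \<alpha> a b) = (Dx ^^ a) ((Dz ^^ b) (Dy (m_el \<alpha> 0 0)))"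
      "Dt (m_el \<alpha> a b) = (Dx ^^ a) ((Dz ^^ b) (Dt (m_el \<alpha> 0 0)))"
      by (simp_all only: total_derivatives_m(3,4) funpow_0)
    then show ?thesis by (simp only: cM funpow_commute_uqm[OF A(1)] funpow_commute_uqm[OF A(2)] m_compatible)
  next
    case (cU i j)
    show ?thesis unfolding cU by (rule commute_on_xyzt_base) (rule B_xyzt.intros)
  next
    case (cUY i k j)
    show ?thesis unfolding cUY by (rule commute_on_xyzt_base) (rule B_xyzt.intros)
  next
    case (cUZ i l j)
    show ?thesis unfolding cUZ by (rule commute_on_xyzt_base) (rule B_xyzt.intros)
  qed simp_all
qed

lemma funpow_commute_UNIV: "commute_on UNIV f g \<Longrightarrow> f ((g ^^ n) a) = (g ^^ n) (f a)"
  by (rule commute_on_funpow[of UNIV]) simp_all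

text \<open>On the r-coordinates the roles are exchanged: \<open>Dx\<close> and \<open>Dz\<close>
  apply powers of \<open>Dy\<close> and \<open>Dt\<close> to a fixed element, and
  \<open>commute_ty\<close> lets a further \<open>Dy\<close> or \<open>Dt\<close> merge with
  them.\<close>

lemma commute_xyz_yt:
  shows commute_xy: "commute_on UNIV Dx Dy" and commute_xt: "commute_on UNIV Dx Dt"
    and commute_zy: "commute_on UNIV Dy Dz" and commute_zt: "commute_on UNIV Dt Dz"
  by (rule commute_on_D_UNIV, rule_tac c = c in gen_uqm_cases,
      auto simp: commute_on_uqm_gen total_derivatives_r(3,4) funpow_commute_UNIV[OF commute_ty])+

lemma D_r_0 [simp]:
  "Dx (gen (cR \<beta> 0 0)) = u_x * Dx (r_el \<beta>) - Dy (r_el \<beta>)"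
  "Dz (gen (cR \<beta> 0 0)) = u_z * Dx (r_el \<beta>) - Dt (r_el \<beta>)"
  by (simp_all add: total_derivatives_r)

text \<open>For the successor of \<beta> the commutator reduces to a second-order expression in s =
  \<open>r_el \<beta>\<close>. It vanishes for s = -u by the equation, and for later s by the
  relations that express s through its predecessor.\<close>

lemma r_compatible: "Dx (Dz (r_el \<beta>)) = Dz (Dx (r_el \<beta>))"
proof (induction \<beta>)
  case (Suc \<beta>)
  define s where "s = r_el \<beta>"
  have c: "Dx (Dy a) = Dy (Dx a)" "Dx (Dt a) = Dt (Dx a)" "Dz (Dy a) = Dy (Dz a)" "Dz (Dt a) = Dt (Dz a)" for a
    using commute_xyz_yt by (auto simp: commute_on_def)
  have "u_z * Dx (Dx s) - u_x * Dx (Dz s) - Dt (Dx s) + Dy (Dz s) = 0"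
  proof (cases \<beta>)
    case 0
    then show ?thesis by (simp add: s_def G_el_def numeral_2_eq_2)
  next
    case (Suc \<gamma>)
    have s: "Dx s = u_x * Dx (r_el \<gamma>) - Dy (r_el \<gamma>)" "Dz s = u_z * Dx (r_el \<gamma>) - Dt (r_el \<gamma>)"
      by (simp_all add: s_def Suc)
    show ?thesis unfolding s using commute_ty
      by (simp add: G_el_def c commute_on_def algebra_simps numeral_2_eq_2)
  qed
  moreover have "Dx (Dz s) = Dz (Dx s)" using Suc by (simp add: s_def)
  ultimately show ?case by (simp add: c algebra_simps flip: s_def)
qed simp

lemma commute_xz: "commute_on UNIV Dx Dz"
proof (rule commute_on_D_UNIV)
  fix c
  show "Dx (Dz (gen c)) = Dz (Dx (gen c))"
  proof (cases rule: gen_uqm_cases[of c])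
    case (3 \<beta> a b)
    have "Dx (gen (cR \<beta> a b)) = (Dy ^^ a) ((Dt ^^ b) (Dx (r_el (Suc \<beta>))))"
      "Dz (gen (cR \<beta> a b)) = (Dy ^^ a) ((Dt ^^ b) (Dz (r_el (Suc \<beta>))))"
      by (simp_all add: total_derivatives_r)
    then show ?thesis
      using 3 r_compatible[of "Suc \<beta>"] commute_xyz_yt
      by (simp add: funpow_commute_UNIV commute_on_commute[of _ Dz] del: r_el.simps)
  qed (auto simp: commute_on_uqm_gen)
qed

lemma D_commute:
  "Dz (Dx a) = Dx (Dz a)" "Dy (Dx a) = Dx (Dy a)" "Dt (Dx a) = Dx (Dt a)"
  "Dy (Dz a) = Dz (Dy a)" "Dt (Dz a) = Dz (Dt a)" "Dt (Dy a) = Dy (Dt a)"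
  using commute_xyz_yt commute_xz commute_ty by (auto simp: commute_on_def)

section \<open>The determining equations under the recursion operators\<close>

text \<open>From here on derivatives of coordinates are expanded only on request, so
  \<open>q_x\<close>, \<open>m_x\<close> and \<open>r_x\<close> stay symbols.\<close>

declare D_u [simp del] D_q [simp del] D_m [simp del] D_r [simp del]
  D_q_yt [simp del] D_m_yt [simp del] D_r_0 [simp del]

lemma gen_mult_eq_0 [simp]: "gen c * a = 0 \<longleftrightarrow> a = 0"
proof
  assume "gen c * a = 0"
  then have "inverse (gen c) * (gen c * a) = 0" by simp
  moreover have "inverse (gen c) * (gen c * a) = gen c * inverse (gen c) * a" by (simp only: ac_simps)
  ultimately show "a = 0" by simp
qed simp

lemma gen_mult_cancel [simp]: "gen c * a = gen c * b \<longleftrightarrow> a = b"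
  using gen_mult_eq_0[of c "a - b"] by (simp only: right_diff_distrib) simp

text \<open>The algebra is not a field, so cancellation of t is provided in the shapes that
  \<open>algebra_simps\<close> leaves behind.\<close>

lemma t_cancel: "t_el * (inverse t_el * a) = a" "t_el * (b * (inverse t_el * a)) = b * a"
  "t_el * (b * (c * (inverse t_el * a))) = b * (c * a)"
  "t_el * (a * inverse t_el) = a" "t_el * (b * (a * inverse t_el)) = b * a"
proof -
  show 1: "t_el * (inverse t_el * a) = a" for a
    by (simp flip: mult.assoc)
  show "t_el * (b * (inverse t_el * a)) = b * a"
    using 1[of "b * a"] by (simp only: ac_simps)
  show "t_el * (b * (c * (inverse t_el * a))) = b * (c * a)"
    using 1[of "b * (c * a)"] by (simp only: ac_simps)
  show "t_el * (a * inverse t_el) = a" "t_el * (b * (a * inverse t_el)) = b * a"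
    using 1[of a] 1[of "b * a"] by (simp_all only: ac_simps)
qed

text \<open>These derivatives are single coordinates, hence units of the algebra.\<close>

lemma q_x_eq: "q_x \<alpha> = gen (cQ \<alpha> 1 0)" and m_x_eq: "m_x \<alpha> = gen (cM \<alpha> 1 0)"
  by (simp_all add: D_q D_m)

text \<open>With \<open>r_x 0 = - u_x\<close> and \<open>comp_r P 0 = - comp_0 P\<close>, the
  r-formula includes the one for \<open>comp_0\<close> as \<beta> = 0.\<close>

lemma comp_Rq:
  "comp_0 (Rq P) = u_x * comp_0 P + comp_r P (Suc 0)"
  "comp_q (Rq P) \<alpha> = q_x \<alpha> * comp_0 P + prev (comp_q P) \<alpha>"
  "comp_m (Rq P) \<alpha> = m_x \<alpha> * comp_0 P - inverse t_el * (prev (comp_m P) \<alpha> + z_el * comp_m P \<alpha>)"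
  "comp_r (Rq P) \<beta> = r_x \<beta> * comp_0 P - comp_r P (Suc \<beta>)"
proof -
  show 0: "comp_0 (Rq P) = u_x * comp_0 P + comp_r P (Suc 0)"
    by (simp add: Rq_def comp_mk_seq)
  have "comp_r (Rq P) 0 = - comp_0 (Rq P)" by (simp add: comp_r_def comp_0_def)
  then show "comp_r (Rq P) \<beta> = r_x \<beta> * comp_0 P - comp_r P (Suc \<beta>)"
    unfolding 0 by (cases \<beta>) (simp_all add: Rq_def comp_mk_seq D_u)
qed (simp_all add: Rq_def comp_mk_seq divide_alg_def algebra_simps)

lemma comp_Rm:
  "comp_0 (Rm P) = t_el * comp_0 (Rq P) + z_el * comp_0 P"
  "comp_q (Rm P) \<alpha> = t_el * comp_q (Rq P) \<alpha> + z_el * comp_q P \<alpha>"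
  "comp_m (Rm P) \<alpha> = t_el * comp_m (Rq P) \<alpha> + z_el * comp_m P \<alpha>"
  "comp_r (Rm P) \<beta> = t_el * comp_r (Rq P) \<beta> + z_el * comp_r P \<beta>"
  by (simp_all add: Rm_def comp_0_def comp_q_def comp_m_def comp_r_def)

lemma comp_r_0: "comp_r P 0 = - comp_0 P"
  by (simp add: comp_r_def comp_0_def)

text \<open>
  The equations (NS2)--(NS9) come in pairs of the same shape, with \<open>(D, E, w)\<close> standing for
  \<open>(Dt, Dz, u_z)\<close> or \<open>(Dy, Dx, u_x)\<close>; (NS6) and (NS7) are the case \<open>\<beta> = 0\<close> of \<open>defect_r\<close>.
\<close>

definition defect_q :: "(alg \<Rightarrow> alg) \<Rightarrow> (alg \<Rightarrow> alg) \<Rightarrow> alg \<Rightarrow> seqA \<Rightarrow> nat \<Rightarrow> alg" where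
  "defect_q D E w P \<alpha> = D (comp_q P \<alpha>) - w * Dx (comp_q P \<alpha>) - q_x \<alpha> * E (comp_0 P)
     - E (prev (comp_q P) \<alpha>)"

definition defect_m :: "(alg \<Rightarrow> alg) \<Rightarrow> (alg \<Rightarrow> alg) \<Rightarrow> alg \<Rightarrow> seqA \<Rightarrow> nat \<Rightarrow> alg" where
  "defect_m D E w P \<alpha> = D (comp_m P \<alpha>) - w * Dx (comp_m P \<alpha>) - m_x \<alpha> * E (comp_0 P)
     + inverse t_el * (z_el * E (comp_m P \<alpha>) + E (prev (comp_m P) \<alpha>))"

definition defect_r :: "(alg \<Rightarrow> alg) \<Rightarrow> (alg \<Rightarrow> alg) \<Rightarrow> alg \<Rightarrow> seqA \<Rightarrow> nat \<Rightarrow> alg" where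
  "defect_r D E w P \<beta> = E (comp_r P (Suc \<beta>)) - w * Dx (comp_r P \<beta>) - r_x \<beta> * E (comp_0 P)
     + D (comp_r P \<beta>)"

definition solves :: "(alg \<Rightarrow> alg) \<Rightarrow> (alg \<Rightarrow> alg) \<Rightarrow> alg \<Rightarrow> seqA \<Rightarrow> bool" where
  "solves D E w P \<longleftrightarrow>
    (\<forall>n. defect_q D E w P n = 0 \<and> defect_m D E w P n = 0 \<and> defect_r D E w P n = 0)"

lemma all_nat_shift: "(\<forall>n\<ge>2. Q n) \<longleftrightarrow> (\<forall>n. Q (Suc (Suc n)))"
  by (metis add_2_eq_Suc le_add1 le_iff_add)

text \<open>(NS1) is the compatibility condition of (NS6) and (NS7).\<close>

lemma sym_A_iff: "P \<in> sym_A \<longleftrightarrow> solves Dy Dx u_x P \<and> solves Dt Dz u_z P"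
proof -
  have "Dz 2 = 0" using D_linear(3)[of 1 1] by simp
  \<comment> \<open>In this cross-differentiation the second derivatives of
    \<open>comp_r P 1\<close> cancel.\<close>
  then have 0: "Dy (Dz (comp_0 P)) - Dt (Dx (comp_0 P)) + u_z * Dx (Dx (comp_0 P)) - u_x * Dx (Dz (comp_0 P))
       + u_xx * Dz (comp_0 P) - u_xz * Dx (comp_0 P)
       = Dx (defect_r Dt Dz u_z P 0) - Dz (defect_r Dy Dx u_x P 0)"
    by (simp add: defect_r_def comp_r_0 D_u D_commute algebra_simps numeral_2_eq_2)
  have q: "(\<forall>\<alpha>. Dt (comp_q P \<alpha>) - u_z * Dx (comp_q P \<alpha>) - q_x \<alpha> * Dz (comp_0 P)
       - Dz (prev (comp_q P) \<alpha>) = 0) \<longleftrightarrow> (\<forall>n. defect_q Dt Dz u_z P n = 0)"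
    "(\<forall>\<alpha>. Dy (comp_q P \<alpha>) - u_x * Dx (comp_q P \<alpha>) - q_x \<alpha> * Dx (comp_0 P)
       - Dx (prev (comp_q P) \<alpha>) = 0) \<longleftrightarrow> (\<forall>n. defect_q Dy Dx u_x P n = 0)"
    by (simp_all only: defect_q_def)
  have m: "(\<forall>\<alpha>. Dt (comp_m P \<alpha>) - u_z * Dx (comp_m P \<alpha>) - m_x \<alpha> * Dz (comp_0 P)
       + z_el / t_el * Dz (comp_m P \<alpha>) + 1 / t_el * Dz (prev (comp_m P) \<alpha>) = 0)
      \<longleftrightarrow> (\<forall>n. defect_m Dt Dz u_z P n = 0)"
    "(\<forall>\<alpha>. Dy (comp_m P \<alpha>) - u_x * Dx (comp_m P \<alpha>) - m_x \<alpha> * Dx (comp_0 P)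
       + z_el / t_el * Dx (comp_m P \<alpha>) + 1 / t_el * Dx (prev (comp_m P) \<alpha>) = 0)
      \<longleftrightarrow> (\<forall>n. defect_m Dy Dx u_x P n = 0)"
    by (simp_all add: defect_m_def divide_alg_def algebra_simps)
  have r0: "Dx (comp_r P 1) - Dy (comp_0 P) + 2 * u_x * Dx (comp_0 P) = defect_r Dy Dx u_x P 0"
    "Dz (comp_r P 1) - Dt (comp_0 P) + u_x * Dz (comp_0 P) + u_z * Dx (comp_0 P) = defect_r Dt Dz u_z P 0"
    by (simp_all add: defect_r_def comp_r_0 D_u algebra_simps)
  have r: "(\<forall>\<beta>\<ge>2. Dx (comp_r P \<beta>) - u_x * Dx (comp_r P (\<beta> - 1)) - r_x (\<beta> - 1) * Dx (comp_0 P)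
       + Dy (comp_r P (\<beta> - 1)) = 0) \<longleftrightarrow> (\<forall>n. defect_r Dy Dx u_x P (Suc n) = 0)"
    "(\<forall>\<beta>\<ge>2. Dz (comp_r P \<beta>) - u_z * Dx (comp_r P (\<beta> - 1)) - r_x (\<beta> - 1) * Dz (comp_0 P)
       + Dt (comp_r P (\<beta> - 1)) = 0) \<longleftrightarrow> (\<forall>n. defect_r Dt Dz u_z P (Suc n) = 0)"
    by (simp_all only: all_nat_shift diff_Suc_1 defect_r_def)
  have all: "(\<forall>n. Q n) \<longleftrightarrow> Q 0 \<and> (\<forall>n. Q (Suc n))" for Q
    by (metis nat.exhaust)
  show ?thesis
    unfolding sym_A_def mem_Collect_eq 0 q m r r0 solves_def all_conj_distrib
      all[of "\<lambda>n. defect_r _ _ _ _ n = 0"]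
    by auto
qed

text \<open>Facts about coordinates are checked for each of the two triples; the identities built on
  them are then proved once for both.\<close>

locale total_derivative_pair =
  fixes D E :: "alg \<Rightarrow> alg" and w :: alg
  assumes pair: "(D, E, w) \<in> {(Dy, Dx, u_x), (Dt, Dz, u_z)}"
begin

lemma linear [simp]:
  "D (a + b) = D a + D b" "E (a + b) = E a + E b" "D (a - b) = D a - D b" "E (a - b) = E a - E b"
  "D (- a) = - D a" "E (- a) = - E a" "D 0 = 0" "E 0 = 0"
  using pair by auto

lemma Leibniz [simp]: "D (a * b) = D a * b + a * D b" "E (a * b) = E a * b + a * E b"
  using pair by auto

text \<open>\<open>E z_el\<close> is 0 for the first triple and 1 for the second, and so is
  \<open>D t_el\<close>.\<close>

lemma coordinates [simp]:
  "D z_el = 0" "E t_el = 0" "D t_el = E z_el"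
  "E (inverse t_el) = 0" "D (inverse t_el) = - (E z_el * (inverse t_el * inverse t_el))"
  using pair by auto

lemma commute_x: "D (Dx a) = Dx (D a)" "E (Dx a) = Dx (E a)"
  using pair by (auto simp: D_commute)

lemma E_u_x: "E (u_el (Suc 0) 0) = Dx w"
  using pair by (auto simp: D_u)

text \<open>The covering relation for q, differentiated by x; the next two lemmas do the same for m
  and r.\<close>

lemma D_q_x: "D (q_x \<alpha>) = Dx w * q_x \<alpha> + w * Dx (q_x \<alpha>) + prev (\<lambda>\<gamma>. E (q_x \<gamma>)) \<alpha>"
  unfolding commute_x using pair by (cases \<alpha>) (auto simp: D_q_yt D_q)

lemma D_m_x: "D (m_x \<alpha>) = Dx w * m_x \<alpha> + w * Dx (m_x \<alpha>)
    - inverse t_el * (z_el * E (m_x \<alpha>) + prev (\<lambda>\<gamma>. E (m_x \<gamma>)) \<alpha>)"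
  unfolding commute_x using pair by (cases \<alpha>) (auto simp: D_m_yt D_m divide_alg_def algebra_simps)

lemma E_r_x: "E (r_x (Suc \<beta>)) = Dx w * r_x \<beta> + w * Dx (r_x \<beta>) - D (r_x \<beta>)"
  unfolding commute_x using pair by (auto simp: D_r_0)

text \<open>Terms with undifferentiated \<open>comp_0 P\<close> cancel by the differentiated
  covering relations. What the first entry of \<open>Rq P\<close> contributes collects into
  multiples of \<open>defect_r D E w P 0\<close>.\<close>

lemma defect_Rq:
  "defect_q D E w (Rq P) \<alpha> = prev (defect_q D E w P) \<alpha> - q_x \<alpha> * defect_r D E w P 0"
  "defect_m D E w (Rq P) \<alpha> = - (m_x \<alpha> * defect_r D E w P 0)
     - inverse t_el * (prev (defect_m D E w P) \<alpha> + z_el * defect_m D E w P \<alpha>)"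
  "defect_r D E w (Rq P) \<beta> = - defect_r D E w P (Suc \<beta>) - r_x \<beta> * defect_r D E w P 0"
proof -
  have r0: "defect_r D E w P 0 = E (comp_r P (Suc 0)) + w * Dx (comp_0 P) + u_x * E (comp_0 P) - D (comp_0 P)"
    by (simp add: defect_r_def comp_r_0 D_u)
  show "defect_q D E w (Rq P) \<alpha> = prev (defect_q D E w P) \<alpha> - q_x \<alpha> * defect_r D E w P 0"
    unfolding r0
    by (cases \<alpha>) (simp_all add: defect_q_def comp_Rq D_q_x E_u_x algebra_simps)
  show "defect_m D E w (Rq P) \<alpha> = - (m_x \<alpha> * defect_r D E w P 0)
     - inverse t_el * (prev (defect_m D E w P) \<alpha> + z_el * defect_m D E w P \<alpha>)"
    unfolding r0
    by (cases \<alpha>) (simp_all add: defect_m_def comp_Rq D_m_x E_u_x algebra_simps)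
  show "defect_r D E w (Rq P) \<beta> = - defect_r D E w P (Suc \<beta>) - r_x \<beta> * defect_r D E w P 0"
    unfolding r0
    by (simp add: defect_r_def comp_Rq E_r_x E_u_x algebra_simps del: r_el.simps)
qed

text \<open>The product rule yields extra terms with \<open>D t_el\<close> and with
  \<open>E z_el\<close>; they cancel because these two are equal.\<close>

lemma defect_Rm:
  "defect_q D E w (Rm P) \<alpha> = t_el * defect_q D E w (Rq P) \<alpha> + z_el * defect_q D E w P \<alpha>"
  "defect_m D E w (Rm P) \<alpha> = t_el * defect_m D E w (Rq P) \<alpha> + z_el * defect_m D E w P \<alpha>"
  "defect_r D E w (Rm P) \<beta> = t_el * defect_r D E w (Rq P) \<beta> + z_el * defect_r D E w P \<beta>"
proof -
  show "defect_q D E w (Rm P) \<alpha> = t_el * defect_q D E w (Rq P) \<alpha> + z_el * defect_q D E w P \<alpha>"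
    by (cases \<alpha>) (simp_all add: defect_q_def comp_Rm comp_Rq algebra_simps)
  show "defect_m D E w (Rm P) \<alpha> = t_el * defect_m D E w (Rq P) \<alpha> + z_el * defect_m D E w P \<alpha>"
    by (cases \<alpha>) (simp_all add: defect_m_def comp_Rm comp_Rq algebra_simps t_cancel)
  show "defect_r D E w (Rm P) \<beta> = t_el * defect_r D E w (Rq P) \<beta> + z_el * defect_r D E w P \<beta>"
    by (simp add: defect_r_def comp_Rm comp_Rq algebra_simps)
qed

text \<open>The system \<open>defect_Rq\<close> is triangular: the q-equation at 0 kills
  \<open>defect_r\<close> at 0, as \<open>q_x 0\<close> is a unit. The rest follows index by index,
  with z as the leading coefficient in the m-equations.\<close>

lemma solves_Rq: "solves D E w (Rq P) \<longleftrightarrow> solves D E w P"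
proof
  assume "solves D E w (Rq P)"
  then have *: "prev (defect_q D E w P) n = q_x n * defect_r D E w P 0"
    "- (m_x n * defect_r D E w P 0)
     - inverse t_el * (prev (defect_m D E w P) n + z_el * defect_m D E w P n) = 0"
    "- defect_r D E w P (Suc n) - r_x n * defect_r D E w P 0 = 0" for n
    using defect_Rq[of P n] by (simp_all add: solves_def)
  have r0: "defect_r D E w P 0 = 0" using *(1)[of 0] by (simp add: D_q)
  have "defect_r D E w P n = 0" for n
    using r0 *(3) by (cases n) simp_all
  moreover have "defect_q D E w P n = 0" for n
    using *(1)[of "Suc n"] r0 by simp
  moreover have m: "prev (defect_m D E w P) n + z_el * defect_m D E w P n = 0" for n
  proof -
    have "t_el * (inverse t_el * (prev (defect_m D E w P) n + z_el * defect_m D E w P n)) = 0"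
      using *(2)[of n] r0 by (simp del: gen_mult_eq_0)
    then show ?thesis by (simp only: t_cancel)
  qed
  have "defect_m D E w P n = 0" for n
  proof (induction n)
    case 0
    then show ?case using m[of 0] by simp
  next
    case (Suc n)
    then show ?case using m[of "Suc n"] by simp
  qed
  ultimately show "solves D E w P" by (simp add: solves_def)
next
  assume P: "solves D E w P"
  then have "prev (defect_q D E w P) n = 0" "prev (defect_m D E w P) n = 0" for n
    by (cases n; simp add: solves_def)+
  with P show "solves D E w (Rq P)" by (simp add: solves_def defect_Rq)
qed

text \<open>Adding z times P removes the diagonal term of the m-equations. These now yield
  \<open>defect_r\<close> at 0 and all of \<open>defect_m\<close>, while the r- and q-equations
  become recurrences with leading coefficients t and z.\<close>

lemma solves_Rm: "solves D E w (Rm P) \<longleftrightarrow> solves D E w P"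
proof
  assume "solves D E w (Rm P)"
  then have *: "t_el * (prev (defect_q D E w P) n - q_x n * defect_r D E w P 0) + z_el * defect_q D E w P n = 0"
    "- (t_el * (m_x n * defect_r D E w P 0)) - prev (defect_m D E w P) n = 0"
    "- (t_el * defect_r D E w P (Suc n)) - t_el * (r_x n * defect_r D E w P 0) + z_el * defect_r D E w P n = 0" for n
    using defect_Rm[of P n] by (simp_all add: solves_def defect_Rq right_diff_distrib distrib_left t_cancel)
  have r0: "defect_r D E w P 0 = 0" using *(2)[of 0] by (simp add: D_m)
  have "defect_r D E w P n = 0" for n
  proof (induction n)
    case (Suc n)
    then show ?case using *(3)[of n] r0 by simp
  qed (rule r0)
  moreover have "defect_m D E w P n = 0" for n
    using *(2)[of "Suc n"] r0 by simp
  moreover have "defect_q D E w P n = 0" for n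
  proof (induction n)
    case 0
    then show ?case using *(1)[of 0] r0 by simp
  next
    case (Suc n)
    then show ?case using *(1)[of "Suc n"] r0 by simp
  qed
  ultimately show "solves D E w P" by (simp add: solves_def)
next
  assume P: "solves D E w P"
  then have "solves D E w (Rq P)" by (simp add: solves_Rq)
  with P show "solves D E w (Rm P)" by (simp add: solves_def defect_Rm)
qed

end

interpretation yx: total_derivative_pair Dy Dx u_x
  by unfold_locales simp

interpretation tz: total_derivative_pair Dt Dz u_z
  by unfold_locales simp

lemma Rq_in_sym_A_iff: "Rq P \<in> sym_A \<longleftrightarrow> P \<in> sym_A"
  by (simp only: sym_A_iff yx.solves_Rq tz.solves_Rq)

lemma Rm_in_sym_A_iff: "Rm P \<in> sym_A \<longleftrightarrow> P \<in> sym_A"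
  by (simp only: sym_A_iff yx.solves_Rm tz.solves_Rm)

section \<open>Linearity\<close>

lemma D_scaleR:
  "Dx (a *\<^sub>R b) = a *\<^sub>R Dx b" "Dy (a *\<^sub>R b) = a *\<^sub>R Dy b"
  "Dz (a *\<^sub>R b) = a *\<^sub>R Dz b" "Dt (a *\<^sub>R b) = a *\<^sub>R Dt b"
proof -
  have "vfield v (a *\<^sub>R b) = a *\<^sub>R vfield v b" for v
  proof -
    have "vfield v (a *\<^sub>R b) = (\<Sum>c | pdiff c b \<noteq> 0. v c * pdiff c (a *\<^sub>R b))"
      by (rule vfield_superset) (auto simp: pdiff_finite pdiff_scaleR)
    then show ?thesis by (simp add: vfield_def pdiff_scaleR scaleR_sum_right)
  qed
  then show "Dx (a *\<^sub>R b) = a *\<^sub>R Dx b" "Dy (a *\<^sub>R b) = a *\<^sub>R Dy b"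
    "Dz (a *\<^sub>R b) = a *\<^sub>R Dz b" "Dt (a *\<^sub>R b) = a *\<^sub>R Dt b"
    by (simp_all add: Dx_def Dy_def Dz_def Dt_def)
qed

text \<open>The entry \<open>P 0\<close> is covered by \<open>comp_r\<close> at index 0, its
  negative.\<close>

lemma seq_eqI:
  assumes "\<And>n. comp_q P n = comp_q P' n" "\<And>n. comp_m P n = comp_m P' n" "\<And>n. comp_r P n = comp_r P' n"
  shows "P = P'"
proof
  fix n :: nat
  have "n = 3 * (n div 3) \<or> n = 3 * (n div 3) + 1 \<or> n = 3 * (n div 3) + 2" by presburger
  then show "P n = P' n"
    using assms[of "n div 3"] by (auto simp: comp_q_def comp_m_def comp_r_def split: if_splits)
qed

lemma comp_linear:
  "comp_0 (P + Q) = comp_0 P + comp_0 Q" "comp_q (P + Q) n = comp_q P n + comp_q Q n"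
  "comp_m (P + Q) n = comp_m P n + comp_m Q n" "comp_r (P + Q) n = comp_r P n + comp_r Q n"
  "comp_0 (a *\<^sub>R P) = a *\<^sub>R comp_0 P" "comp_q (a *\<^sub>R P) n = a *\<^sub>R comp_q P n"
  "comp_m (a *\<^sub>R P) n = a *\<^sub>R comp_m P n" "comp_r (a *\<^sub>R P) n = a *\<^sub>R comp_r P n"
  by (simp_all add: comp_0_def comp_q_def comp_m_def comp_r_def scaleR_fun_def)

lemma prev_linear:
  "prev (comp_q (P + Q)) n = prev (comp_q P) n + prev (comp_q Q) n"
  "prev (comp_m (P + Q)) n = prev (comp_m P) n + prev (comp_m Q) n"
  "prev (comp_q (a *\<^sub>R P)) n = a *\<^sub>R prev (comp_q P) n"
  "prev (comp_m (a *\<^sub>R P)) n = a *\<^sub>R prev (comp_m P) n"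
  by (cases n; simp add: comp_linear)+

lemma (in total_derivative_pair) solves_linear:
  "solves D E w P \<Longrightarrow> solves D E w Q \<Longrightarrow> solves D E w (P + Q)"
  "solves D E w P \<Longrightarrow> solves D E w (a *\<^sub>R P)"
proof -
  have "D (a *\<^sub>R b) = a *\<^sub>R D b" "E (a *\<^sub>R b) = a *\<^sub>R E b" for b
    using pair by (auto simp: D_scaleR)
  then have "defect_q D E w (a *\<^sub>R P) n = a *\<^sub>R defect_q D E w P n"
    "defect_m D E w (a *\<^sub>R P) n = a *\<^sub>R defect_m D E w P n"
    "defect_r D E w (a *\<^sub>R P) n = a *\<^sub>R defect_r D E w P n" for n
    by (simp_all add: defect_q_def defect_m_def defect_r_def comp_linear prev_linear D_scaleR
        distrib_left scaleR_add_right scaleR_diff_right del: D_prev)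
  then show "solves D E w P \<Longrightarrow> solves D E w (a *\<^sub>R P)" by (simp add: solves_def)
  have "defect_q D E w (P + Q) n = defect_q D E w P n + defect_q D E w Q n"
    "defect_m D E w (P + Q) n = defect_m D E w P n + defect_m D E w Q n"
    "defect_r D E w (P + Q) n = defect_r D E w P n + defect_r D E w Q n" for n
    by (simp_all add: defect_q_def defect_m_def defect_r_def comp_linear prev_linear algebra_simps del: D_prev)
  then show "solves D E w P \<Longrightarrow> solves D E w Q \<Longrightarrow> solves D E w (P + Q)" by (simp add: solves_def)
qed

lemma subspace_sym_A: "subspace sym_A"
proof (rule subspaceI)
  have "P \<in> sym_A \<Longrightarrow> a *\<^sub>R P \<in> sym_A" for a P
    by (simp only: sym_A_iff yx.solves_linear tz.solves_linear)
  then show "P \<in> sym_A \<Longrightarrow> a *\<^sub>R P \<in> sym_A" for a P .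
  have 0: "comp_0 0 = 0" "comp_q 0 = (\<lambda>n. 0)" "comp_m 0 = (\<lambda>n. 0)" "comp_r 0 = (\<lambda>n. 0)"
    by (simp_all add: comp_0_def comp_q_def comp_m_def comp_r_def fun_eq_iff)
  have "prev (\<lambda>n. 0 :: alg) n = 0" for n by (cases n) simp_all
  then show "0 \<in> sym_A"
    by (simp add: sym_A_iff solves_def defect_q_def defect_m_def defect_r_def 0 del: D_prev)
  show "P \<in> sym_A \<Longrightarrow> Q \<in> sym_A \<Longrightarrow> P + Q \<in> sym_A" for P Q
    by (simp only: sym_A_iff yx.solves_linear tz.solves_linear)
qed

lemma Rq_linear: "Rq (P + Q) = Rq P + Rq Q" "Rq (a *\<^sub>R P) = a *\<^sub>R Rq P"
  by (rule seq_eqI; simp add: comp_Rq comp_linear prev_linear algebra_simps)+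

lemma Rm_linear: "Rm (P + Q) = Rm P + Rm Q" "Rm (a *\<^sub>R P) = a *\<^sub>R Rm P"
  by (rule seq_eqI; simp add: comp_Rm Rq_linear comp_linear algebra_simps)+

section \<open>Inverting the recursion operators\<close>

text \<open>Variation of constants. In the applications y is the inverse of the leading coefficient,
  up to sign.\<close>

lemma linear_recurrence:
  fixes f :: "nat \<Rightarrow> 'a::comm_ring_1"
  assumes "\<And>n. f (Suc n) = y * (g n + s * f n)"
  shows "f (Suc n) = s ^ Suc n * y ^ Suc n * f 0 + (\<Sum>j=0..n. s ^ (n - j) * g j * y ^ (n - j + 1))"
proof (induction n)
  case 0
  then show ?case by (simp add: assms algebra_simps)
next
  case (Suc n)
  have "(\<Sum>j=0..Suc n. s ^ (Suc n - j) * g j * y ^ (Suc n - j + 1)) =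
      y * g (Suc n) + s * y * (\<Sum>j=0..n. s ^ (n - j) * g j * y ^ (n - j + 1))"
    by (simp add: sum_distrib_left Suc_diff_le mult_ac)
  then show ?case by (subst assms, subst Suc) (simp add: algebra_simps)
qed

lemma gen_mult_eq_iff: "gen c * a = b \<longleftrightarrow> a = inverse (gen c) * b"
proof -
  have "gen c * (inverse (gen c) * b) = b" by (simp flip: mult.assoc)
  then show ?thesis by (metis gen_mult_cancel)
qed

lemma gen_cancel: "gen c * (inverse (gen c) * a) = a" "inverse (gen c) * (gen c * a) = a"
  using gen_mult_eq_iff[of c] by metis+

lemma inverse_unit_power: "a * inverse a = (1::alg) \<Longrightarrow> inverse (a ^ n) = inverse a ^ n"
  by (rule alg_inverse_unique) (simp flip: power_mult_distrib)

lemma inverse_uminus_gen: "inverse (- gen c) = - inverse (gen c)"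
  by (rule alg_inverse_unique) simp

lemma divide_gen_power: "a / gen c ^ n = a * inverse (gen c) ^ n" "a / (- gen c) ^ n = a * (- inverse (gen c)) ^ n"
  using inverse_unit_power[of "gen c" n] inverse_unit_power[of "- gen c" n]
  by (simp_all add: divide_alg_def inverse_uminus_gen)

lemma inverse_gen_mult: "inverse (gen c * gen c') = inverse (gen c) * inverse (gen c')"
  by (rule alg_inverse_unique) (simp add: gen_cancel mult_ac)

text \<open>Since P is an arbitrary sequence here, the formulas also yield injectivity on the whole
  sequence space.\<close>

lemma Rq_inverse_formulas:
  fixes P
  defines "Ph \<equiv> Rq P"
  shows "comp_0 P = comp_q Ph 0 / q_x 0"
    "comp_q P \<alpha> = - (q_x (\<alpha> + 1) / q_x 0) * comp_q Ph 0 + comp_q Ph (\<alpha> + 1)"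
    "comp_m P \<alpha> =
        (\<Sum>j=0..\<alpha>. (t_el * comp_m Ph j) / (- z_el) ^ (\<alpha> - j + 1))
        - ((t_el * comp_q Ph 0) / q_x 0) * (\<Sum>j=0..\<alpha>. m_x j / (- z_el) ^ (\<alpha> - j + 1))"
    "comp_r P (Suc \<beta>) = (r_x \<beta> / q_x 0) * comp_q Ph 0 - comp_r Ph \<beta>"
proof -
  have q0: "comp_q Ph 0 = q_x 0 * comp_0 P" by (simp add: Ph_def comp_Rq)
  have p: "a / q_x 0 * comp_q Ph 0 = a * comp_0 P" "a * comp_q Ph 0 / q_x 0 = a * comp_0 P" for a
    unfolding q0 unfolding q_x_eq divide_alg_def by (simp_all add: gen_cancel mult_ac)
  show "comp_0 P = comp_q Ph 0 / q_x 0" using p(2)[of 1] by simp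
  show "comp_q P \<alpha> = - (q_x (\<alpha> + 1) / q_x 0) * comp_q Ph 0 + comp_q Ph (\<alpha> + 1)"
    unfolding mult_minus_left p by (simp add: Ph_def comp_Rq)
  show "comp_r P (Suc \<beta>) = (r_x \<beta> / q_x 0) * comp_q Ph 0 - comp_r Ph \<beta>"
    unfolding p by (simp add: Ph_def comp_Rq)
  \<comment> \<open>Shifting by \<open>prev\<close> gives the recurrence the initial value 0, so
    only the sum survives.\<close>
  have "prev (comp_m P) (Suc n) =
      - inverse z_el * (t_el * (comp_m Ph n - m_x n * comp_0 P) + 1 * prev (comp_m P) n)" for n
  proof -
    have "z_el * comp_m P n = - (t_el * (comp_m Ph n - m_x n * comp_0 P) + prev (comp_m P) n)"
      by (simp add: Ph_def comp_Rq algebra_simps t_cancel)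
    then show ?thesis unfolding gen_mult_eq_iff by (simp add: algebra_simps)
  qed
  from linear_recurrence[of "prev (comp_m P)", OF this, of \<alpha>]
  show "comp_m P \<alpha> =
        (\<Sum>j=0..\<alpha>. (t_el * comp_m Ph j) / (- z_el) ^ (\<alpha> - j + 1))
        - ((t_el * comp_q Ph 0) / q_x 0) * (\<Sum>j=0..\<alpha>. m_x j / (- z_el) ^ (\<alpha> - j + 1))"
    unfolding p divide_gen_power
    by (simp add: sum_distrib_left sum_subtractf sum_negf algebra_simps)
qed

lemma Rm_inverse_formulas:
  fixes P
  defines "Ph \<equiv> Rm P"
  shows "comp_0 P = comp_m Ph 0 / (t_el * m_x 0)"
    "comp_q P \<alpha> =
        (\<Sum>j=0..\<alpha>. ((- t_el) ^ (\<alpha> - j) * comp_q Ph j) / z_el ^ (\<alpha> - j + 1))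
        - (comp_m Ph 0 / m_x 0) * (\<Sum>j=0..\<alpha>. ((- t_el) ^ (\<alpha> - j) * q_x j) / z_el ^ (\<alpha> - j + 1))"
    "comp_m P \<alpha> = (m_x (\<alpha> + 1) / m_x 0) * comp_m Ph 0 - comp_m Ph (\<alpha> + 1)"
    "comp_r P (Suc \<beta>) =
        - (\<Sum>j=0..\<beta>. (z_el ^ (\<beta> - j) * comp_r Ph j) / t_el ^ (\<beta> - j + 1))
        + (comp_m Ph 0 / m_x 0) *
          (- (z_el ^ Suc \<beta> / t_el ^ (\<beta> + 2))
           + (\<Sum>j=0..\<beta>. (z_el ^ (\<beta> - j) * r_x j) / t_el ^ (\<beta> - j + 1)))"
proof -
  \<comment> \<open>The two terms z times \<open>comp_m P n\<close> cancel, so m is solved without a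
    recurrence.\<close>
  have m: "comp_m Ph n = t_el * m_x n * comp_0 P - prev (comp_m P) n" for n
    by (simp add: Ph_def comp_Rm comp_Rq algebra_simps t_cancel)
  have p: "a / m_x 0 * comp_m Ph 0 = t_el * a * comp_0 P" "comp_m Ph 0 / m_x 0 = t_el * comp_0 P" for a
    unfolding m unfolding m_x_eq divide_alg_def by (simp_all add: gen_cancel mult_ac)
  show "comp_0 P = comp_m Ph 0 / (t_el * m_x 0)"
    unfolding m unfolding m_x_eq divide_alg_def inverse_gen_mult by (simp add: gen_cancel mult_ac)
  show "comp_m P \<alpha> = (m_x (\<alpha> + 1) / m_x 0) * comp_m Ph 0 - comp_m Ph (\<alpha> + 1)"
    unfolding p by (simp add: m)
  have "prev (comp_q P) (Suc n) =
      inverse z_el * ((comp_q Ph n - t_el * q_x n * comp_0 P) + - t_el * prev (comp_q P) n)" for n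
  proof -
    have "z_el * comp_q P n = (comp_q Ph n - t_el * q_x n * comp_0 P) + - t_el * prev (comp_q P) n"
      by (simp add: Ph_def comp_Rm comp_Rq algebra_simps)
    then show ?thesis by (simp add: gen_mult_eq_iff)
  qed
  from linear_recurrence[of "prev (comp_q P)", OF this, of \<alpha>]
  show "comp_q P \<alpha> =
        (\<Sum>j=0..\<alpha>. ((- t_el) ^ (\<alpha> - j) * comp_q Ph j) / z_el ^ (\<alpha> - j + 1))
        - (comp_m Ph 0 / m_x 0) * (\<Sum>j=0..\<alpha>. ((- t_el) ^ (\<alpha> - j) * q_x j) / z_el ^ (\<alpha> - j + 1))"
    unfolding p divide_gen_power
    by (simp add: sum_distrib_left sum_subtractf algebra_simps)
  \<comment> \<open>Here the initial value is \<open>comp_r P 0 = - comp_0 P\<close>; it produces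
    the isolated quotient of powers of z and t.\<close>
  have "comp_r P (Suc n) = inverse t_el * ((t_el * r_x n * comp_0 P - comp_r Ph n) + z_el * comp_r P n)" for n
  proof -
    have "t_el * comp_r P (Suc n) = (t_el * r_x n * comp_0 P - comp_r Ph n) + z_el * comp_r P n"
      by (simp add: Ph_def comp_Rm comp_Rq algebra_simps)
    then show ?thesis by (simp add: gen_mult_eq_iff)
  qed
  from linear_recurrence[of "comp_r P", OF this, of \<beta>]
  show "comp_r P (Suc \<beta>) =
        - (\<Sum>j=0..\<beta>. (z_el ^ (\<beta> - j) * comp_r Ph j) / t_el ^ (\<beta> - j + 1))
        + (comp_m Ph 0 / m_x 0) *
          (- (z_el ^ Suc \<beta> / t_el ^ (\<beta> + 2))
           + (\<Sum>j=0..\<beta>. (z_el ^ (\<beta> - j) * r_x j) / t_el ^ (\<beta> - j + 1)))"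
    unfolding p divide_gen_power comp_r_0
    by (simp add: sum_distrib_left sum_subtractf algebra_simps t_cancel)
qed

section \<open>Bijectivity of the recursion operators\<close>

lemma Rq_surj: "\<exists>P. Rq P = Ph"
proof -
  \<comment> \<open>This value is forced by the q-entry at index 0; \<open>f\<close> then solves the
    m-recurrence, shifted by one so that it starts at 0.\<close>
  define p where "p = inverse (q_x 0) * comp_q Ph 0"
  define f where "f = rec_nat 0 (\<lambda>n a. inverse z_el * (t_el * (m_x n * p - comp_m Ph n) - a))"
  have f: "f 0 = 0" "z_el * f (Suc n) = t_el * (m_x n * p - comp_m Ph n) - f n" for n
    by (simp_all add: f_def gen_cancel)
  \<comment> \<open>\<open>mk_seq\<close> never reads its r-argument at index 0, so the truncated
    \<open>n - 1\<close> is harmless.\<close>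
  define P where "P = mk_seq p (\<lambda>n. comp_q Ph (Suc n) - q_x (Suc n) * p) (\<lambda>n. f (Suc n))
    (\<lambda>n. r_x (n - 1) * p - comp_r Ph (n - 1))"
  have P: "comp_0 P = p" "comp_q P n = comp_q Ph (Suc n) - q_x (Suc n) * p" "comp_m P n = f (Suc n)"
    "comp_r P (Suc n) = r_x n * p - comp_r Ph n" for n
    by (simp_all add: P_def comp_mk_seq)
  have q0: "q_x 0 * p = comp_q Ph 0" unfolding p_def q_x_eq by (simp add: gen_cancel)
  have prev_m: "prev (comp_m P) n = f n" for n by (cases n) (simp_all add: P f)
  have "Rq P = Ph"
  proof (rule seq_eqI)
    show "comp_q (Rq P) n = comp_q Ph n" for n
      by (cases n) (simp_all add: comp_Rq P q0)
    show "comp_m (Rq P) n = comp_m Ph n" for n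
      by (simp add: comp_Rq P prev_m f gen_cancel)
    show "comp_r (Rq P) n = comp_r Ph n" for n
      by (simp add: comp_Rq P)
  qed
  then show ?thesis by blast
qed

lemma Rm_surj: "\<exists>P. Rm P = Ph"
proof -
  define p where "p = inverse t_el * inverse (m_x 0) * comp_m Ph 0"
  define f where "f = rec_nat 0 (\<lambda>n a. inverse z_el * (comp_q Ph n - t_el * (q_x n * p + a)))"
  have f: "f 0 = 0" "z_el * f (Suc n) = comp_q Ph n - t_el * (q_x n * p + f n)" for n
    by (simp_all add: f_def gen_cancel)
  \<comment> \<open>Starting at \<open>- p\<close> makes \<open>g\<close> agree with
    \<open>comp_r P\<close> at index 0 as well.\<close>
  define g where "g = rec_nat (- p) (\<lambda>n a. inverse t_el * (t_el * r_x n * p - comp_r Ph n + z_el * a))"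
  have g: "g 0 = - p" "t_el * g (Suc n) = t_el * r_x n * p - comp_r Ph n + z_el * g n" for n
    by (simp_all add: g_def gen_cancel)
  define P where "P = mk_seq p (\<lambda>n. f (Suc n)) (\<lambda>n. t_el * m_x (Suc n) * p - comp_m Ph (Suc n)) g"
  have P: "comp_0 P = p" "comp_q P n = f (Suc n)" "comp_m P n = t_el * m_x (Suc n) * p - comp_m Ph (Suc n)"
    "comp_r P (Suc n) = g (Suc n)" for n
    by (simp_all add: P_def comp_mk_seq)
  have m0: "p * (t_el * m_x 0) = comp_m Ph 0"
    unfolding p_def m_x_eq by (simp add: mult_ac gen_cancel t_cancel)
  have prev_q: "prev (comp_q P) n = f n" for n by (cases n) (simp_all add: P f)
  have r: "comp_r P n = g n" for n by (cases n) (simp_all add: P comp_r_0 g)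
  have "Rm P = Ph"
  proof (rule seq_eqI)
    show "comp_q (Rm P) n = comp_q Ph n" for n
      by (simp add: comp_Rm comp_Rq P prev_q f)
    show "comp_m (Rm P) n = comp_m Ph n" for n
      by (cases n) (simp_all add: comp_Rm comp_Rq P algebra_simps t_cancel m0)
    show "comp_r (Rm P) n = comp_r Ph n" for n
      by (simp add: comp_Rm comp_Rq P r g right_diff_distrib mult.assoc)
  qed
  then show ?thesis by blast
qed

lemma inj_Rq: "inj Rq"
proof (rule injI, rule seq_eqI)
  fix P P' n assume eq: "Rq P = Rq P'"
  note * = Rq_inverse_formulas[of P, unfolded eq] Rq_inverse_formulas[of P']
  show "comp_q P n = comp_q P' n" by (rule trans[OF *(2) *(6)[symmetric]])
  show "comp_m P n = comp_m P' n" by (rule trans[OF *(3) *(7)[symmetric]])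
  have "comp_0 P = comp_0 P'" by (rule trans[OF *(1) *(5)[symmetric]])
  moreover have "comp_r P (Suc n) = comp_r P' (Suc n)" for n by (rule trans[OF *(4) *(8)[symmetric]])
  ultimately show "comp_r P n = comp_r P' n"
    by (cases n) (simp_all add: comp_r_0)
qed

lemma inj_Rm: "inj Rm"
proof (rule injI, rule seq_eqI)
  fix P P' n assume eq: "Rm P = Rm P'"
  note * = Rm_inverse_formulas[of P, unfolded eq] Rm_inverse_formulas[of P']
  show "comp_q P n = comp_q P' n" by (rule trans[OF *(2) *(6)[symmetric]])
  show "comp_m P n = comp_m P' n" by (rule trans[OF *(3) *(7)[symmetric]])
  have "comp_0 P = comp_0 P'" by (rule trans[OF *(1) *(5)[symmetric]])
  moreover have "comp_r P (Suc n) = comp_r P' (Suc n)" for n by (rule trans[OF *(4) *(8)[symmetric]])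
  ultimately show "comp_r P n = comp_r P' n"
    by (cases n) (simp_all add: comp_r_0)
qed

text \<open>A symmetry has a preimage among all sequences, and this preimage is a symmetry because
  membership in \<open>sym_A\<close> is reflected by both maps.\<close>

lemma bij_betw_sym_A: "bij_betw Rq sym_A sym_A" "bij_betw Rm sym_A sym_A"
proof -
  have "Ph \<in> Rq ` sym_A" "Ph \<in> Rm ` sym_A" if "Ph \<in> sym_A" for Ph
    using that Rq_surj[of Ph] Rm_surj[of Ph] by (metis Rq_in_sym_A_iff Rm_in_sym_A_iff imageI)+
  then show "bij_betw Rq sym_A sym_A" "bij_betw Rm sym_A sym_A"
    using inj_Rq inj_Rm Rq_in_sym_A_iff Rm_in_sym_A_iff
    by (auto simp: bij_betw_def intro: inj_on_subset)
qed

theorem corollary2: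
  shows "automorphism_on sym_A Rq \<and> automorphism_on sym_A Rm \<and>
    (\<forall>Ph\<in>sym_A. \<forall>P. P = inv_into sym_A Rq Ph \<longrightarrow>
      comp_0 P = comp_q Ph 0 / q_x 0 \<and>
      (\<forall>\<alpha>. comp_q P \<alpha> = - (q_x (\<alpha> + 1) / q_x 0) * comp_q Ph 0 + comp_q Ph (\<alpha> + 1)) \<and>
      (\<forall>\<alpha>. comp_m P \<alpha> =
        (\<Sum>j=0..\<alpha>. (t_el * comp_m Ph j) / (- z_el) ^ (\<alpha> - j + 1))
        - ((t_el * comp_q Ph 0) / q_x 0) * (\<Sum>j=0..\<alpha>. m_x j / (- z_el) ^ (\<alpha> - j + 1))) \<and>
      (\<forall>\<beta>\<ge>1. comp_r P \<beta> = (r_x (\<beta> - 1) / q_x 0) * comp_q Ph 0 - comp_r Ph (\<beta> - 1))) \<and>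
    (\<forall>Ph\<in>sym_A. \<forall>P. P = inv_into sym_A Rm Ph \<longrightarrow>
      comp_0 P = comp_m Ph 0 / (t_el * m_x 0) \<and>
      (\<forall>\<alpha>. comp_q P \<alpha> =
        (\<Sum>j=0..\<alpha>. ((- t_el) ^ (\<alpha> - j) * comp_q Ph j) / z_el ^ (\<alpha> - j + 1))
        - (comp_m Ph 0 / m_x 0) * (\<Sum>j=0..\<alpha>. ((- t_el) ^ (\<alpha> - j) * q_x j) / z_el ^ (\<alpha> - j + 1))) \<and>
      (\<forall>\<alpha>. comp_m P \<alpha> = (m_x (\<alpha> + 1) / m_x 0) * comp_m Ph 0 - comp_m Ph (\<alpha> + 1)) \<and>
      (\<forall>\<beta>\<ge>1. comp_r P \<beta> =
        - (\<Sum>j=0..\<beta> - 1. (z_el ^ (\<beta> - j - 1) * comp_r Ph j) / t_el ^ (\<beta> - j))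
        + (comp_m Ph 0 / m_x 0) *
          (- (z_el ^ \<beta> / t_el ^ (\<beta> + 1))
           + (\<Sum>j=1..\<beta>. (z_el ^ (\<beta> - j) * r_x (j - 1)) / t_el ^ (\<beta> - j + 1)))))"
proof (intro conjI ballI allI impI)
  show "automorphism_on sym_A Rq" "automorphism_on sym_A Rm"
    by (simp_all add: automorphism_on_def subspace_sym_A bij_betw_sym_A Rq_linear Rm_linear)
next
  fix Ph P assume "Ph \<in> sym_A" "P = inv_into sym_A Rq Ph"
  then have Ph: "Ph = Rq P"
    using bij_betw_inv_into_right[OF bij_betw_sym_A(1)] by simp
  show "comp_0 P = comp_q Ph 0 / q_x 0"
    "comp_q P \<alpha> = - (q_x (\<alpha> + 1) / q_x 0) * comp_q Ph 0 + comp_q Ph (\<alpha> + 1)"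
    "comp_m P \<alpha> = (\<Sum>j=0..\<alpha>. (t_el * comp_m Ph j) / (- z_el) ^ (\<alpha> - j + 1))
        - ((t_el * comp_q Ph 0) / q_x 0) * (\<Sum>j=0..\<alpha>. m_x j / (- z_el) ^ (\<alpha> - j + 1))" for \<alpha>
    unfolding Ph by (rule Rq_inverse_formulas)+
  show "comp_r P \<beta> = (r_x (\<beta> - 1) / q_x 0) * comp_q Ph 0 - comp_r Ph (\<beta> - 1)" if "\<beta> \<ge> 1" for \<beta>
    using Rq_inverse_formulas(4)[of P "\<beta> - 1"] that by (simp add: Ph)
next
  fix Ph P assume "Ph \<in> sym_A" "P = inv_into sym_A Rm Ph"
  then have Ph: "Ph = Rm P"
    using bij_betw_inv_into_right[OF bij_betw_sym_A(2)] by simp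
  show "comp_0 P = comp_m Ph 0 / (t_el * m_x 0)"
    "comp_q P \<alpha> = (\<Sum>j=0..\<alpha>. ((- t_el) ^ (\<alpha> - j) * comp_q Ph j) / z_el ^ (\<alpha> - j + 1))
        - (comp_m Ph 0 / m_x 0) * (\<Sum>j=0..\<alpha>. ((- t_el) ^ (\<alpha> - j) * q_x j) / z_el ^ (\<alpha> - j + 1))"
    "comp_m P \<alpha> = (m_x (\<alpha> + 1) / m_x 0) * comp_m Ph 0 - comp_m Ph (\<alpha> + 1)" for \<alpha>
    unfolding Ph by (rule Rm_inverse_formulas)+
  fix \<beta> :: nat assume "\<beta> \<ge> 1"
  then obtain n where n: "\<beta> = Suc n" by (cases \<beta>) auto
  \<comment> \<open>Both sums are reindexed from \<beta> to its predecessor n, for which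
    \<open>Rm_inverse_formulas\<close> is stated.\<close>
  have "(\<Sum>j=1..\<beta>. (z_el ^ (\<beta> - j) * r_x (j - 1)) / t_el ^ (\<beta> - j + 1)) =
      (\<Sum>j=0..n. (z_el ^ (n - j) * r_x j) / t_el ^ (n - j + 1))"
    unfolding n One_nat_def sum.shift_bounds_cl_Suc_ivl by simp
  moreover have "(\<Sum>j=0..\<beta> - 1. (z_el ^ (\<beta> - j - 1) * comp_r Ph j) / t_el ^ (\<beta> - j)) =
      (\<Sum>j=0..n. (z_el ^ (n - j) * comp_r Ph j) / t_el ^ (n - j + 1))"
    unfolding n by (intro sum.cong) (auto simp: Suc_diff_le)
  ultimately show "comp_r P \<beta> =
        - (\<Sum>j=0..\<beta> - 1. (z_el ^ (\<beta> - j - 1) * comp_r Ph j) / t_el ^ (\<beta> - j))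
        + (comp_m Ph 0 / m_x 0) *
          (- (z_el ^ \<beta> / t_el ^ (\<beta> + 1))
           + (\<Sum>j=1..\<beta>. (z_el ^ (\<beta> - j) * r_x (j - 1)) / t_el ^ (\<beta> - j + 1)))"
    using Rm_inverse_formulas(4)[of P n] by (simp add: n Ph)
qed

end
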